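(* Let $p(\cdot)\in\mathcal{P}^{\log}(\mathbb{R}^n)$, let $\delta(\cdot)$ be a function on $\mathbb{R}^n$ with $0\le\delta(\cdot)<n$, let $1<\beta<p_-$, and suppose that $p(x)\ge p_\infty$ for a.e. $x\in\mathbb{R}^n$ and $\frac{\delta(\cdot)}{n}=\frac1\beta-\frac{1}{p(\cdot)}$. Then $\mathbb{L}(\delta(\cdot))=\widetilde{\mathbb{L}}(\delta(\cdot))$ with equivalent norms, i.e. the two spaces consist of the same functions and there is a constant $C>0$ independent of $b$ such that $C^{-1}\|b\|_{\widetilde{\mathbb{L}}(\delta(\cdot))}\le\|b\|_{\mathbb{L}(\delta(\cdot))}\le C\|b\|_{\widetilde{\mathbb{L}}(\delta(\cdot))}$.
   Context: $p_-:=\inf_{x\in\mathbb{R}^n}p(x)$ and $p_+:=\sup_{x\in\mathbb{R}^n}p(x)$. $\mathcal{P}(\mathbb{R}^n)$ is the set of measurable $p(\cdot):\mathbb{R}^n\to(1,\infty)$ with $1<p_-\le p_+<\infty$. The conjugate exponent $p'(\cdot)$ is defined by $1/p(\cdot)+1/p'(\cdot)=1$. $\mathcal{P}^{\log}(\mathbb{R}^n)$ is the set of $p(\cdot)\in\mathcal{P}(\mathbb{R}^n)$ for which there exist $C_{\log}(p),C_\infty\in(0,\infty)$ and $p_\infty\in\mathbb{R}$ with $|p(x)-p(y)|\le \frac{C_{\log}(p)}{\ln(e+1/|x-y|)}$ and $|p(x)-p_\infty|\le\frac{C_\infty}{\ln(e+|x|)}$ for all $x,y\in\mathbb{R}^n$.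 For $p(\cdot)\in\mathcal{P}(\mathbb{R}^n)$, $L^{p(\cdot)}(\mathbb{R}^n)$ carries the norm $\|f\|_{L^{p(\cdot)}(\mathbb{R}^n)}=\inf\{\lambda>0:\int_{\mathbb{R}^n}(|f(x)|/\lambda)^{p(x)}dx\le1\}$. Cubes $Q\subset\mathbb{R}^n$ have sides parallel to the coordinate axes; $|Q|$ is Lebesgue measure, $\chi_Q$ the characteristic function, $b_Q:=|Q|^{-1}\int_Qb(x)\,dx$. Pointwise type: $b\in\mathbb{L}(\delta(\cdot))$ if there is a constant $C$ with $|b(x)-b(y)|\le C|x-y|^{\delta(x)}$ for all $x,y\in\mathbb{R}^n$; the smallest such $C$ is $\|b\|_{\mathbb{L}(\delta(\cdot))}$. Integral type: a locally integrable $b$ is in $\widetilde{\mathbb{L}}(\delta(\cdot))$ if $\|b\|_{\widetilde{\mathbb{L}}(\delta(\cdot))}:=\sup_Q\frac{1}{|Q|^{1/\beta}\|\chi_Q\|_{L^{p'(\cdot)}(\mathbb{R}^n)}}\int_Q|b(x)-b_Q|\,dx<\infty$, the supremum being over all cubes $Q$. Functions equal almost everywhere are identified (membership in $\mathbb{L}(\delta(\cdot))$ is understood after possibly changing $b$ on a null set). "Norm" here means seminorm (constants have norm zero). *)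

theory Defs
  imports "HOL-Analysis.Analysis"
begin

text \<open>
  Euclidean space of dimension \<open>n\<close> is \<open>real ^ 'n\<close> with \<open>n = CARD('n)\<close>.  Inferior and superior
  bounds that may be infinite, and the (semi)norms, are extended-valued, so that the infimum
  over an empty set is infinite and an unbounded supremum is infinite.
\<close>

section \<open>Variable exponents\<close>

definition p_minus :: "(real ^ 'n \<Rightarrow> real) \<Rightarrow> ereal" where
  "p_minus p = (INF x. ereal (p x))"

definition p_plus :: "(real ^ 'n \<Rightarrow> real) \<Rightarrow> ereal" where
  "p_plus p = (SUP x. ereal (p x))"

definition exponents :: "(real ^ 'n \<Rightarrow> real) set" where
  "exponents = {p \<in> borel_measurable lebesgue.
     (\<forall>x. 1 < p x) \<and> 1 < p_minus p \<and> p_minus p \<le> p_plus p \<and> p_plus p < \<infinity>}"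

definition conj_exponent :: "(real ^ 'n \<Rightarrow> real) \<Rightarrow> real ^ 'n \<Rightarrow> real" where
  "conj_exponent p x = 1 / (1 - 1 / p x)"

lemma conj_exponent_iff:
  assumes "1 < p x"
  shows "1 / p x + 1 / q = 1 \<longleftrightarrow> q = conj_exponent p x"
proof -
  have "1 - 1 / p x \<noteq> 0"
    using assms by simp
  then show ?thesis
    unfolding conj_exponent_def by (cases "q = 0") (auto simp: field_simps)
qed

text \<open>For \<open>x = y\<close> the bound below reads \<open>0 \<le> C\<close>, because \<open>1 / 0 = 0\<close> and \<open>ln (exp 1) = 1\<close>;
  with the convention that \<open>1 / 0\<close> is infinite it would read \<open>0 \<le> 0\<close>.  Both hold trivially.\<close>

definition log_holder :: "(real ^ 'n \<Rightarrow> real) \<Rightarrow> bool" where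
  "log_holder p \<longleftrightarrow>
     (\<exists>C>0. \<forall>x y. \<bar>p x - p y\<bar> \<le> C / ln (exp 1 + 1 / norm (x - y)))"

definition log_holder_at_infinity :: "(real ^ 'n \<Rightarrow> real) \<Rightarrow> real \<Rightarrow> bool" where
  "log_holder_at_infinity p p_inf \<longleftrightarrow>
     (\<exists>C>0. \<forall>x. \<bar>p x - p_inf\<bar> \<le> C / ln (exp 1 + norm x))"

definition log_exponents :: "(real ^ 'n \<Rightarrow> real) set" where
  "log_exponents = {p \<in> exponents. log_holder p \<and> (\<exists>p_inf. log_holder_at_infinity p p_inf)}"

definition luxemburg_norm ::
    "(real ^ 'n \<Rightarrow> real) \<Rightarrow> (real ^ 'n \<Rightarrow> 'a::real_normed_vector) \<Rightarrow> ennreal" where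
  "luxemburg_norm p f =
     (INF t \<in> {t::real. t > 0 \<and>
         (\<integral>\<^sup>+ x. ennreal ((norm (f x) / t) powr p x) \<partial>lebesgue) \<le> 1}. ennreal t)"

section \<open>Lipschitz spaces of variable order\<close>

definition cubes :: "(real ^ 'n) set set" where
  "cubes = {cbox a (\<chi> i. a $ i + l) | a l. 0 < l}"

definition average :: "(real ^ 'n) set \<Rightarrow> (real ^ 'n \<Rightarrow> 'a::euclidean_space) \<Rightarrow> 'a" where
  "average Q b = (1 / measure lebesgue Q) *\<^sub>R (LINT x:Q|lebesgue. b x)"

definition locally_integrable :: "(real ^ 'n \<Rightarrow> 'a::euclidean_space) \<Rightarrow> bool" where
  "locally_integrable b \<longleftrightarrow> (\<forall>K. compact K \<longrightarrow> b absolutely_integrable_on K)"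

definition lip_bound ::
    "(real ^ 'n \<Rightarrow> real) \<Rightarrow> (real ^ 'n \<Rightarrow> 'a::real_normed_vector) \<Rightarrow> real \<Rightarrow> bool" where
  "lip_bound \<delta> b C \<longleftrightarrow> 0 \<le> C \<and> (\<forall>x y. norm (b x - b y) \<le> C * norm (x - y) powr \<delta> x)"

text \<open>The pointwise space and its seminorm refer to individual functions; the identification
  of functions that agree almost everywhere is made by \<open>ae_class\<close>.\<close>

definition pointwise_Lip ::
    "(real ^ 'n \<Rightarrow> real) \<Rightarrow> (real ^ 'n \<Rightarrow> 'a::real_normed_vector) set" where
  "pointwise_Lip \<delta> = {b. \<exists>C. lip_bound \<delta> b C}"

definition pointwise_Lip_norm ::
    "(real ^ 'n \<Rightarrow> real) \<Rightarrow> (real ^ 'n \<Rightarrow> 'a::real_normed_vector) \<Rightarrow> ennreal" where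
  "pointwise_Lip_norm \<delta> b = (INF C \<in> {C. lip_bound \<delta> b C}. ennreal C)"

definition ae_class :: "(real ^ 'n \<Rightarrow> 'a) set \<Rightarrow> (real ^ 'n \<Rightarrow> 'a) set" where
  "ae_class X = {b. \<exists>b'\<in>X. AE x in lebesgue. b x = b' x}"

text \<open>The order \<open>\<delta>\<close> enters the integral space only through \<open>\<beta>\<close> and \<open>p\<close>, to which it is tied by
  \<open>\<delta> x / n = 1 / \<beta> - 1 / p x\<close>.\<close>

definition integral_Lip_norm ::
    "real \<Rightarrow> (real ^ 'n \<Rightarrow> real) \<Rightarrow> (real ^ 'n \<Rightarrow> 'a::euclidean_space) \<Rightarrow> ennreal" where
  "integral_Lip_norm \<beta> p b =
     (SUP Q \<in> cubes.
        (\<integral>\<^sup>+ x\<in>Q. ennreal (norm (b x - average Q b)) \<partial>lebesgue) /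
        (ennreal (measure lebesgue Q powr (1 / \<beta>)) *
           luxemburg_norm (conj_exponent p) (indicat_real Q)))"

definition integral_Lip ::
    "real \<Rightarrow> (real ^ 'n \<Rightarrow> real) \<Rightarrow> (real ^ 'n \<Rightarrow> 'a::euclidean_space) set" where
  "integral_Lip \<beta> p = {b. locally_integrable b \<and> integral_Lip_norm \<beta> p b < \<infinity>}"

end

(* Let \<phi> x l be the minimum of l powr \<delta> x and l powr \<delta>_inf, where \<delta>_inf is the order that belongs to p_inf.
   Since p is log-Hoelder continuous and p_inf \<le> p, a cube Q of side l containing x satisfies
   |Q|^(1/\<beta>) ||chi_Q||_p' ~ l^n \<phi> x l, so the integral seminorm compares the mean oscillation over Q
   with \<phi> x l.  A pointwise Lipschitz function has small oscillation over Q because Q contains a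
   point x of norm at least l/2, where l powr \<delta> x is comparable to \<phi> x l.  Conversely, the averages
   over shrinking cubes with corner x converge geometrically to a function b' with the pointwise
   bound.  Equality of b and b' almost everywhere does not need Lebesgue differentiation: the
   integral of |b - b'| over a cube of side l is at most A l^(n + \<delta>_inf), and subdividing cubes
   shows that A can be taken to be 0. *)

theory Submission
  imports Defs
begin

section \<open>Cubes and averages\<close>

text \<open>The obstacle is the behaviour on large cubes: the pointwise condition at
  \<open>x\<close> allows growth \<open>l powr \<delta> x\<close>, while \<open>||chi_Q||_p'\<close>
  sees, up to constants, only the order at infinity, which may be smaller. Two facts bridge this
  gap. The pointwise inequality takes its exponent at one of the two points only, so all values on a
  cube can be compared with the value at a single well placed point. In the other direction,
  \<open>p_inf \<le> p\<close> makes every order at least the one at infinity; hence the minimum is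
  \<open>l powr \<delta> x\<close> for \<open>l \<le> 1\<close> and the power at infinity for
  \<open>l \<ge> 1\<close>, and a bound by \<phi> is in particular a pointwise bound. Since \<beta>
  stays strictly below the infimum of \<open>p\<close>, all orders have a common positive lower
  bound, which makes the ratio of the geometric series less than 1. No constant depends on
  \<open>b\<close>, and all bounds are linear in the seminorm.\<close>

definition cube :: "real ^ 'n \<Rightarrow> real \<Rightarrow> (real ^ 'n) set" where
  "cube a l = cbox a (\<chi> i. a $ i + l)"

lemma mem_cube: "x \<in> cube a l \<longleftrightarrow> (\<forall>i. a $ i \<le> x $ i \<and> x $ i \<le> a $ i + l)"
  by (auto simp: cube_def mem_box_cart)

lemma cubes_eq: "cubes = {cube a l | a l. 0 < l}"
  by (simp add: cubes_def cube_def)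

lemma compact_cube: "compact (cube a l)"
  by (simp add: cube_def)

lemma cube_sets [simp, measurable]: "cube a l \<in> sets lebesgue"
  by (simp add: cube_def)

lemma measure_cube:
  fixes a :: "real ^ 'n"
  assumes "0 \<le> l"
  shows "measure lebesgue (cube a l) = l ^ CARD('n)"
proof -
  have "a \<in> cube a l"
    using assms by (simp add: mem_cube)
  then have "cbox a (\<chi> i. a $ i + l) \<noteq> {}"
    by (auto simp: cube_def)
  then show ?thesis
    by (simp add: cube_def content_cbox_cart)
qed

lemma emeasure_cube:
  fixes a :: "real ^ 'n"
  assumes "0 \<le> l"
  shows "emeasure lebesgue (cube a l) = ennreal (l ^ CARD('n))"
proof -
  have "emeasure lebesgue (cube a l) = ennreal (measure lebesgue (cube a l))"
    unfolding cube_def by (intro emeasure_eq_measure2 lmeasurable_cbox)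
  then show ?thesis
    using assms by (simp add: measure_cube)
qed

lemma cube_subsetI:
  assumes "\<And>i. a $ i \<le> a' $ i" "\<And>i. a' $ i + r \<le> a $ i + l"
  shows "cube a' r \<subseteq> cube a l"
  unfolding mem_cube subset_iff by (meson assms add_right_mono order_trans)

lemma norm_diff_cube:
  fixes x y :: "real ^ 'n"
  assumes "x \<in> cube a l" "y \<in> cube a l"
  shows "norm (x - y) \<le> real CARD('n) * l"
proof -
  have "norm (x - y) \<le> (\<Sum>i\<in>UNIV. \<bar>(x - y) $ i\<bar>)"
    by (rule norm_le_l1_cart)
  also have "\<dots> \<le> (\<Sum>i\<in>(UNIV::'n set). l)"
  proof (rule sum_mono)
    fix i :: 'n
    have "a $ i \<le> x $ i" "x $ i \<le> a $ i + l" "a $ i \<le> y $ i" "y $ i \<le> a $ i + l"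
      using assms by (auto simp: mem_cube)
    then show "\<bar>(x - y) $ i\<bar> \<le> l"
      by simp
  qed
  finally show ?thesis
    by simp
qed

text \<open>A constant is its own average, so \<open>average Q b - c\<close> is the average of
  \<open>b - c\<close>. The form without division lets bounds on the right pass to real
  numbers.\<close>

lemma norm_average_diff_le:
  fixes b :: "real ^ 'n \<Rightarrow> 'a::euclidean_space"
  assumes b: "b absolutely_integrable_on cube a l" and l: "0 < l"
  shows "ennreal (l ^ CARD('n) * norm (average (cube a l) b - c))
     \<le> (\<integral>\<^sup>+x\<in>cube a l. ennreal (norm (b x - c)) \<partial>lebesgue)"
proof -
  let ?Q = "cube a l"
  have pos: "0 < l ^ CARD('n)"
    using l by simp
  have fin: "emeasure lebesgue ?Q < \<infinity>"
    unfolding emeasure_cube[OF less_imp_le[OF l]] by simp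
  have c: "integrable lebesgue (\<lambda>x. indicat_real ?Q x *\<^sub>R c)"
    using fin by (intro integrable_scaleR_left integrable_real_indicator) auto
  have b': "integrable lebesgue (\<lambda>x. indicat_real ?Q x *\<^sub>R b x)"
    using b by (simp add: set_integrable_def)
  have int: "integrable lebesgue (\<lambda>x. indicat_real ?Q x *\<^sub>R (b x - c))"
    using Bochner_Integration.integrable_diff[OF b' c] by (simp add: algebra_simps)
  have "(LINT x|lebesgue. indicat_real ?Q x *\<^sub>R (b x - c))
      = (LINT x|lebesgue. indicat_real ?Q x *\<^sub>R b x) - (LINT x|lebesgue. indicat_real ?Q x *\<^sub>R c)"
    using Bochner_Integration.integral_diff[OF b' c] by (simp add: algebra_simps)
  also have "(LINT x|lebesgue. indicat_real ?Q x *\<^sub>R c) = l ^ CARD('n) *\<^sub>R c"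
    using fin l by (simp add: measure_cube)
  also have "(LINT x|lebesgue. indicat_real ?Q x *\<^sub>R b x) - l ^ CARD('n) *\<^sub>R c
      = l ^ CARD('n) *\<^sub>R (average ?Q b - c)"
    using pos l by (simp add: average_def set_lebesgue_integral_def measure_cube scaleR_diff_right)
  finally have "l ^ CARD('n) * norm (average ?Q b - c)
      = norm (LINT x|lebesgue. indicat_real ?Q x *\<^sub>R (b x - c))"
    using pos by simp
  also have "ennreal \<dots> \<le> (\<integral>\<^sup>+x. ennreal (norm (indicat_real ?Q x *\<^sub>R (b x - c))) \<partial>lebesgue)"
    by (rule integral_norm_bound_ennreal[OF int])
  also have "\<dots> = (\<integral>\<^sup>+x\<in>?Q. ennreal (norm (b x - c)) \<partial>lebesgue)"
    by (intro nn_integral_cong) (auto simp: indicator_def)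
  finally show ?thesis .
qed

lemma locally_integrable_measurable:
  fixes b :: "real ^ 'n \<Rightarrow> 'a::euclidean_space"
  assumes "locally_integrable b"
  shows "b \<in> borel_measurable lebesgue"
proof (rule borel_measurable_LIMSEQ_metric)
  fix k :: nat
  have "b absolutely_integrable_on cball 0 (real k)"
    using assms by (simp add: locally_integrable_def)
  then show "(\<lambda>x. indicat_real (cball 0 (real k)) x *\<^sub>R b x) \<in> borel_measurable lebesgue"
    by (simp add: set_integrable_def)
next
  fix x :: "real ^ 'n"
  obtain N :: nat where N: "norm x \<le> real N"
    using real_arch_simple by blast
  have "\<forall>\<^sub>F k in sequentially. indicat_real (cball 0 (real k)) x *\<^sub>R b x = b x"
    using eventually_ge_at_top[of N]
    by eventually_elim (use N in \<open>auto simp: indicator_def\<close>)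
  then show "(\<lambda>k. indicat_real (cball 0 (real k)) x *\<^sub>R b x) \<longlonglongrightarrow> b x"
    by (rule tendsto_eventually)
qed

lemma average_cong_AE:
  fixes b b' :: "real ^ 'n \<Rightarrow> 'a::euclidean_space"
  assumes "AE x in lebesgue. b x = b' x" "b \<in> borel_measurable lebesgue"
    "b' \<in> borel_measurable lebesgue"
  shows "average (cube a l) b = average (cube a l) b'"
proof -
  have "(LINT x:cube a l|lebesgue. b x) = (LINT x:cube a l|lebesgue. b' x)"
    unfolding set_lebesgue_integral_def using assms
    by (intro integral_cong_AE) auto
  then show ?thesis
    by (simp add: average_def)
qed

text \<open>Continuity at \<open>x\<close> involves only the exponent at \<open>x\<close>, so a
  variable order does no harm as long as it is positive.\<close>

lemma continuous_on_of_lip_bound: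
  fixes b :: "real ^ 'n \<Rightarrow> 'a::real_normed_vector"
  assumes b: "lip_bound \<delta> b B" and \<delta>: "\<And>x. 0 < \<delta> x"
  shows "continuous_on UNIV b"
proof (rule continuous_at_imp_continuous_on, rule ballI)
  fix x :: "real ^ 'n"
  have "((\<lambda>y. norm (x - y)) \<longlongrightarrow> norm (x - x)) (at x)"
    by (intro tendsto_intros)
  then have "((\<lambda>y. norm (x - y)) \<longlongrightarrow> 0) (at x)"
    by simp
  then have "((\<lambda>y. norm (x - y) powr \<delta> x) \<longlongrightarrow> 0 powr \<delta> x) (at x)"
    using \<delta>[of x] by (intro tendsto_powr'[OF _ tendsto_const]) auto
  then have "((\<lambda>y. B * norm (x - y) powr \<delta> x) \<longlongrightarrow> B * 0 powr \<delta> x) (at x)"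
    by (rule tendsto_mult_left)
  then have lim: "((\<lambda>y. B * norm (x - y) powr \<delta> x) \<longlongrightarrow> 0) (at x)"
    by simp
  have "((\<lambda>y. b y - b x) \<longlongrightarrow> 0) (at x)"
  proof (rule tendsto_0_le[OF lim, of _ 1], rule always_eventually, rule allI)
    fix y
    have "norm (b y - b x) \<le> B * norm (x - y) powr \<delta> x"
      using b by (metis lip_bound_def norm_minus_commute)
    then show "norm (b y - b x) \<le> norm (B * norm (x - y) powr \<delta> x) * 1"
      by simp
  qed
  then show "isCont b x"
    by (simp add: isCont_def LIM_zero_iff)
qed

lemma locally_integrable_continuous:
  fixes b :: "real ^ 'n \<Rightarrow> 'a::euclidean_space"
  assumes "continuous_on UNIV b"
  shows "locally_integrable b"
  unfolding locally_integrable_def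
proof (intro allI impI)
  fix S :: "(real ^ 'n) set"
  assume S: "compact S"
  then have int: "integrable lborel (\<lambda>x. indicator S x *\<^sub>R b x)"
    using assms by (intro borel_integrable_compact) (auto intro: continuous_on_subset)
  then have "(\<lambda>x. indicator S x *\<^sub>R b x) \<in> borel_measurable lborel"
    by (rule borel_measurable_integrable)
  then show "b absolutely_integrable_on S"
    unfolding set_integrable_def using int by (simp add: integrable_completion)
qed

lemma locally_integrable_cong_AE:
  fixes b b' :: "real ^ 'n \<Rightarrow> 'a::euclidean_space"
  assumes "AE x in lebesgue. b x = b' x" "locally_integrable b'"
  shows "locally_integrable b"
proof -
  obtain N where N: "{x. b x \<noteq> b' x} \<subseteq> N" "N \<in> null_sets lebesgue"
    using assms(1) by (auto simp: eventually_ae_filter)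
  then have "negligible N"
    by (simp add: negligible_iff_null_sets)
  then show ?thesis
    using assms(2) N(1) unfolding locally_integrable_def
    by (blast intro: absolutely_integrable_spike)
qed

lemma integral_Lip_norm_cong_AE:
  fixes b b' :: "real ^ 'n \<Rightarrow> 'a::euclidean_space"
  assumes ae: "AE x in lebesgue. b x = b' x" and "locally_integrable b'"
  shows "integral_Lip_norm \<beta> p b = integral_Lip_norm \<beta> p b'"
proof -
  have "average Q b = average Q b'" if "Q \<in> cubes" for Q
    using that average_cong_AE[OF ae] locally_integrable_cong_AE[OF assms] assms(2)
    by (auto simp: cubes_eq locally_integrable_measurable)
  moreover have "(\<integral>\<^sup>+x\<in>Q. ennreal (norm (b x - c)) \<partial>lebesgue)
      = (\<integral>\<^sup>+x\<in>Q. ennreal (norm (b' x - c)) \<partial>lebesgue)" for Q c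
    using ae by (intro nn_integral_cong_AE) auto
  ultimately show ?thesis
    unfolding integral_Lip_norm_def by (intro SUP_cong) auto
qed

text \<open>The set of disagreement is open and null, hence empty. This makes the pointwise
  seminorm, which depends on individual values, well defined on a class of functions equal almost
  everywhere.\<close>

lemma continuous_eq_if_AE_eq:
  fixes f g :: "real ^ 'n \<Rightarrow> 'a::real_normed_vector"
  assumes f: "continuous_on UNIV f" and g: "continuous_on UNIV g"
    and ae: "AE x in lebesgue. f x = g x"
  shows "f x = g x"
proof -
  let ?U = "{x. f x - g x \<noteq> 0}"
  have "open ?U"
    using f g by (intro open_Collect_neq continuous_intros)
  moreover have "negligible ?U"
  proof -
    obtain N where "?U \<subseteq> N" "N \<in> null_sets lebesgue"
      using ae by (auto simp: eventually_ae_filter)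
    then show ?thesis
      using negligible_subset by (auto simp: negligible_iff_null_sets[symmetric])
  qed
  ultimately have "?U = {}"
    using open_not_negligible by blast
  then show ?thesis by auto
qed

section \<open>Dyadic subdivision and functions that vanish almost everywhere\<close>

lemma cube_subset_halves:
  fixes a :: "real ^ 'n"
  shows "cube a l \<subseteq> (\<Union>S\<in>UNIV. cube (\<chi> i. a $ i + (if i \<in> S then l / 2 else 0)) (l / 2))"
proof
  fix x assume x: "x \<in> cube a l"
  \<comment> \<open>\<open>S\<close> records the coordinates in which \<open>x\<close> lies in the
    upper half. The closed subcubes share faces, but only the covering matters.\<close>
  define S where "S = {i. a $ i + l / 2 < x $ i}"
  have "x \<in> cube (\<chi> i. a $ i + (if i \<in> S then l / 2 else 0)) (l / 2)"
    unfolding mem_cube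
  proof
    fix i
    show "(\<chi> i. a $ i + (if i \<in> S then l / 2 else 0)) $ i \<le> x $ i \<and>
      x $ i \<le> (\<chi> i. a $ i + (if i \<in> S then l / 2 else 0)) $ i + l / 2"
      using x[unfolded mem_cube, rule_format, of i] by (auto simp: S_def)
  qed
  then show "x \<in> (\<Union>S\<in>UNIV. cube (\<chi> i. a $ i + (if i \<in> S then l / 2 else 0)) (l / 2))"
    by blast
qed

text \<open>Halving the cubes improves the constant \<open>A\<close> by the factor \<open>2 powr - d\<close>.\<close>

lemma AE_zero_of_small_on_cubes:
  fixes g :: "real ^ 'n \<Rightarrow> ennreal"
  assumes g [measurable]: "g \<in> borel_measurable lebesgue" and d: "0 < d" and A: "0 \<le> A"
    and le: "\<And>a l. 0 < l \<Longrightarrow>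
      (\<integral>\<^sup>+x\<in>cube a l. g x \<partial>lebesgue) \<le> ennreal (A * l ^ CARD('n) * l powr d)"
  shows "AE x in lebesgue. g x = 0"
proof -
  have improve: "(\<integral>\<^sup>+x\<in>cube a l. g x \<partial>lebesgue)
      \<le> ennreal ((2 powr - d) ^ k * A * l ^ CARD('n) * l powr d)"
    if "0 < l" for a l k
    using that
  proof (induction k arbitrary: a l)
    case 0
    then show ?case using le by simp
  next
    case (Suc k)
    let ?c = "\<lambda>S. cube (\<chi> i. a $ i + (if i \<in> S then l / 2 else 0)) (l / 2)"
    have "(\<integral>\<^sup>+x\<in>cube a l. g x \<partial>lebesgue) \<le> (\<integral>\<^sup>+x. (\<Sum>S\<in>UNIV. g x * indicator (?c S) x) \<partial>lebesgue)"
    proof (rule nn_integral_mono)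
      fix x
      show "g x * indicator (cube a l) x \<le> (\<Sum>S\<in>UNIV. g x * indicator (?c S) x)"
      proof (cases "x \<in> cube a l")
        case True
        then obtain S where S: "x \<in> ?c S"
          using cube_subset_halves[of a l] by blast
        have "g x * indicator (?c S) x \<le> (\<Sum>S\<in>UNIV. g x * indicator (?c S) x)"
          by (rule member_le_sum) auto
        then show ?thesis
          using S True by simp
      qed simp
    qed
    also have "\<dots> = (\<Sum>S\<in>UNIV. (\<integral>\<^sup>+x\<in>?c S. g x \<partial>lebesgue))"
      by (intro nn_integral_sum) measurable
    also have "\<dots> \<le> (\<Sum>S\<in>(UNIV::'n set set).
        ennreal ((2 powr - d) ^ k * A * (l / 2) ^ CARD('n) * (l / 2) powr d))"
      by (intro sum_mono Suc.IH) (use Suc.prems in simp)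
    also have "\<dots> = ennreal (2 ^ CARD('n) * ((2 powr - d) ^ k * A * (l / 2) ^ CARD('n) * (l / 2) powr d))"
      using A Suc.prems by (simp add: ennreal_mult' card_Pow flip: Pow_UNIV ennreal_power)
    \<comment> \<open>The number of subcubes cancels against their volume ratio; the gain comes from
      \<open>(l / 2) powr d\<close> alone.\<close>
    also have "2 ^ CARD('n) * ((2 powr - d) ^ k * A * (l / 2) ^ CARD('n) * (l / 2) powr d)
        = (2 powr - d) ^ Suc k * A * l ^ CARD('n) * l powr d"
      using Suc.prems by (simp add: power_divide powr_divide powr_minus divide_simps)
    finally show ?case .
  qed
  have zero: "(\<integral>\<^sup>+x\<in>cube a l. g x \<partial>lebesgue) = 0" if l: "0 < l" for a l
  proof -
    have "2 powr - d < (1::real)"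
      using d by (simp add: powr_minus divide_simps)
    then have "(\<lambda>k. (2 powr - d) ^ k * (A * l ^ CARD('n) * l powr d)) \<longlonglongrightarrow> 0 * (A * l ^ CARD('n) * l powr d)"
      by (intro tendsto_mult LIMSEQ_realpow_zero tendsto_const) auto
    then have "(\<lambda>k. ennreal ((2 powr - d) ^ k * A * l ^ CARD('n) * l powr d)) \<longlonglongrightarrow> ennreal 0"
      by (intro tendsto_ennrealI) (simp add: mult.assoc)
    then have "(\<integral>\<^sup>+x\<in>cube a l. g x \<partial>lebesgue) \<le> ennreal 0"
      using improve[OF l] by (intro tendsto_lowerbound[where F = sequentially]) auto
    then show ?thesis by simp
  qed
  \<comment> \<open>Countably many cubes around the origin exhaust the space; \<open>Suc k\<close>
    keeps their sides positive, as \<open>zero\<close> demands.\<close>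
  have "AE x in lebesgue. \<forall>k::nat. g x * indicator (cube (\<chi> i. - real (Suc k)) (2 * real (Suc k))) x = 0"
    unfolding AE_all_countable
  proof
    fix k :: nat
    show "AE x in lebesgue. g x * indicator (cube (\<chi> i. - real (Suc k)) (2 * real (Suc k))) x = 0"
      by (subst nn_integral_0_iff_AE[symmetric]) (auto intro!: zero)
  qed
  then show ?thesis
  proof eventually_elim
    fix x assume *: "\<forall>k::nat. g x * indicator (cube (\<chi> i. - real (Suc k)) (2 * real (Suc k))) x = 0"
    obtain k :: nat where k: "norm x \<le> real k"
      using real_arch_simple by blast
    have "- real (Suc k) \<le> x $ i \<and> x $ i \<le> real (Suc k)" for i
      using component_le_norm_cart[of x i] k by auto
    then have "x \<in> cube (\<chi> i. - real (Suc k)) (2 * real (Suc k))"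
      by (simp add: mem_cube)
    then show "g x = 0"
      using *[rule_format, of k] by simp
  qed
qed

section \<open>Functions whose mean oscillation is controlled by a growth function\<close>

text \<open>This isolates what the Campanato-Meyers argument uses: \<open>half\<close> makes sums
  over halved sides geometric, \<open>double\<close> allows passing to a larger cube,
  \<open>comparable\<close> moves the base point, and \<open>le_powr\<close> supplies one order
  valid at all points.\<close>

locale growth_function =
  fixes \<phi> :: "real ^ 'n \<Rightarrow> real \<Rightarrow> real" and d K D :: real
  assumes d: "0 < d"
    and nonneg: "0 \<le> \<phi> x l"
    and half: "0 < l \<Longrightarrow> \<phi> x (l / 2) \<le> 2 powr - d * \<phi> x l"
    and double: "0 < l \<Longrightarrow> \<phi> x (2 * l) \<le> D * \<phi> x l"
    and comparable: "0 < l \<Longrightarrow> norm (x - y) \<le> real CARD('n) * l \<Longrightarrow> \<phi> y l \<le> K * \<phi> x l"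
    and le_powr: "0 < l \<Longrightarrow> \<phi> x l \<le> l powr d"
    and D: "0 \<le> D" and K: "0 \<le> K"
begin

text \<open>The sum of the geometric series with ratio \<open>2 powr - d\<close>;
  \<open>geom_eq\<close> is its recursion, which closes the induction in
  \<open>telescope\<close>.\<close>

definition geom :: real where
  "geom = 1 / (1 - 2 powr - d)"

lemma geom_ge_1: "1 \<le> geom" and geom_eq: "geom * 2 powr - d + 1 = geom"
proof -
  have "2 powr - d < (1::real)" "0 < (2::real) powr - d"
    using d by (simp_all add: powr_minus divide_simps)
  then show "1 \<le> geom" "geom * 2 powr - d + 1 = geom"
    using d by (simp_all add: geom_def add_divide_distrib[symmetric] divide_simps)
qed

text \<open>\<open>2 ^ n\<close> is the volume ratio for a halved side, \<open>geom\<close> comes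
  from telescoping, \<open>D\<close> from doubling cubes, and \<open>1 + K\<close> from adding the
  estimates at two points.\<close>

definition const :: real where
  "const = 2 ^ CARD('n) * (geom + 2 * D) * (1 + K)"

lemma const_nonneg: "0 \<le> const"
  using geom_ge_1 D K by (simp add: const_def)

end

text \<open>The oscillation bound holds for every \<open>x\<close> in the cube, so each use may take
  \<phi> at the point where the final estimate is wanted.\<close>

locale controlled_oscillation = growth_function \<phi> d K D
  for \<phi> :: "real ^ 'n \<Rightarrow> real \<Rightarrow> real" and d K D +
  fixes b :: "real ^ 'n \<Rightarrow> 'a::euclidean_space" and M :: real
  assumes loc: "locally_integrable b" and M: "0 \<le> M"
    and osc: "0 < l \<Longrightarrow> x \<in> cube a l \<Longrightarrow>
      (\<integral>\<^sup>+y\<in>cube a l. ennreal (norm (b y - average (cube a l) b)) \<partial>lebesgue)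
        \<le> ennreal (M * l ^ CARD('n) * \<phi> x l)"
begin

text \<open>The integral of \<open>norm (b - average Q b)\<close> over a subcube is at most that
  over \<open>Q\<close>; since \<open>l \<le> 2 * r\<close>, division by the smaller volume costs at
  most \<open>2 ^ n\<close>.\<close>

lemma average_diff:
  assumes r: "0 < r" and l: "0 < l" "l \<le> 2 * r" and sub: "cube a' r \<subseteq> cube a l"
    and x: "x \<in> cube a l"
  shows "norm (average (cube a' r) b - average (cube a l) b) \<le> 2 ^ CARD('n) * M * \<phi> x l"
proof -
  have int: "b absolutely_integrable_on cube a' r"
    using loc compact_cube unfolding locally_integrable_def by blast
  have "ennreal (r ^ CARD('n) * norm (average (cube a' r) b - average (cube a l) b))
      \<le> (\<integral>\<^sup>+y\<in>cube a' r. ennreal (norm (b y - average (cube a l) b)) \<partial>lebesgue)"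
    by (rule norm_average_diff_le[OF int r])
  also have "\<dots> \<le> (\<integral>\<^sup>+y\<in>cube a l. ennreal (norm (b y - average (cube a l) b)) \<partial>lebesgue)"
    using sub by (intro nn_integral_mono) (auto simp: indicator_def)
  also have "\<dots> \<le> ennreal (M * l ^ CARD('n) * \<phi> x l)"
    by (rule osc[OF l(1) x])
  finally have "r ^ CARD('n) * norm (average (cube a' r) b - average (cube a l) b)
      \<le> M * l ^ CARD('n) * \<phi> x l"
    using M nonneg l by (simp add: ennreal_le_iff)
  also have "\<dots> \<le> M * (2 * r) ^ CARD('n) * \<phi> x l"
    using M nonneg l by (intro mult_right_mono mult_left_mono power_mono) auto
  also have "\<dots> = r ^ CARD('n) * (2 ^ CARD('n) * M * \<phi> x l)"
    by (simp add: power_mult_distrib)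
  finally show ?thesis
    using r by (simp add: mult_le_cancel_left_pos)
qed

lemma mem_cube_corner: "0 < l \<Longrightarrow> x \<in> cube x l"
  by (simp add: mem_cube)

text \<open>The side \<open>l\<close> is halved until it is at most \<open>2 * r\<close>; by
  \<open>half\<close> the errors of these steps decay geometrically. \<open>k\<close> merely bounds
  the number of halvings.\<close>

lemma telescope:
  assumes "0 < r" "r \<le> l" "l \<le> 2 ^ k * r"
  shows "norm (average (cube x r) b - average (cube x l) b) \<le> 2 ^ CARD('n) * M * geom * \<phi> x l"
  using assms
proof (induction k arbitrary: l)
  case 0
  then show ?case
    using M nonneg geom_ge_1 by simp
next
  case (Suc k)
  have l: "0 < l"
    using Suc.prems by simp
  show ?case
  proof (cases "l \<le> 2 * r")
    case True
    have "norm (average (cube x r) b - average (cube x l) b) \<le> 2 ^ CARD('n) * M * \<phi> x l"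
      using Suc.prems l True
      by (intro average_diff mem_cube_corner cube_subsetI) auto
    also have "\<dots> \<le> 2 ^ CARD('n) * M * \<phi> x l * geom"
      using mult_left_mono[OF geom_ge_1, of "2 ^ CARD('n) * M * \<phi> x l"] M nonneg by simp
    finally show ?thesis
      by (simp add: mult_ac)
  next
    case False
    have "norm (average (cube x r) b - average (cube x l) b)
        \<le> norm (average (cube x r) b - average (cube x (l / 2)) b)
          + norm (average (cube x (l / 2)) b - average (cube x l) b)"
      by norm
    also have "\<dots> \<le> 2 ^ CARD('n) * M * geom * \<phi> x (l / 2) + 2 ^ CARD('n) * M * \<phi> x l"
    proof (rule add_mono)
      show "norm (average (cube x r) b - average (cube x (l / 2)) b)
          \<le> 2 ^ CARD('n) * M * geom * \<phi> x (l / 2)"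
        using False Suc.prems by (intro Suc.IH) auto
      show "norm (average (cube x (l / 2)) b - average (cube x l) b) \<le> 2 ^ CARD('n) * M * \<phi> x l"
        using l by (intro average_diff mem_cube_corner cube_subsetI) auto
    qed
    also have "\<dots> \<le> 2 ^ CARD('n) * M * geom * (2 powr - d * \<phi> x l) + 2 ^ CARD('n) * M * \<phi> x l"
      using M geom_ge_1 half[OF l] by (intro add_right_mono mult_left_mono) auto
    also have "\<dots> = 2 ^ CARD('n) * M * (geom * 2 powr - d + 1) * \<phi> x l"
      by (simp add: algebra_simps)
    finally show ?thesis
      by (simp only: geom_eq)
  qed
qed

text \<open>The cubes share the corner \<open>x\<close> instead of a centre; some power of 2 exceeds
  \<open>l / r\<close>.\<close>

lemma average_diff_concentric:
  assumes "0 < r" "r \<le> l"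
  shows "norm (average (cube x r) b - average (cube x l) b) \<le> 2 ^ CARD('n) * M * geom * \<phi> x l"
proof -
  obtain k where "l / r < 2 ^ k"
    using real_arch_pow[of 2 "l / r"] by auto
  then show ?thesis
    using assms by (intro telescope[where k = k]) (auto simp: field_simps)
qed

section \<open>The limit of the averages\<close>

definition representative :: "real ^ 'n \<Rightarrow> 'a" where
  "representative x = lim (\<lambda>k. average (cube x ((1 / 2) ^ k)) b)"

text \<open>At side \<open>(1 / 2) ^ j\<close>, \<open>le_powr\<close> bounds \<phi> by the
  \<open>j\<close>-th power of \<open>(1 / 2) powr d\<close>, a number below 1. So the averages form
  a Cauchy sequence.\<close>

lemma average_tendsto: "(\<lambda>k. average (cube x ((1 / 2) ^ k)) b) \<longlonglongrightarrow> representative x"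
proof -
  let ?u = "\<lambda>k::nat. average (cube x ((1 / 2) ^ k)) b"
  define E where "E = 2 ^ CARD('n) * M * geom"
  have E: "0 \<le> E"
    using M geom_ge_1 by (simp add: E_def)
  have bound: "norm (?u k - ?u j) \<le> E * ((1 / 2) powr d) ^ j" if "j \<le> k" for j k
  proof -
    have "norm (?u k - ?u j) \<le> E * \<phi> x ((1 / 2) ^ j)"
      unfolding E_def using that by (intro average_diff_concentric power_decreasing) auto
    also have "\<dots> \<le> E * ((1 / 2) ^ j) powr d"
      using E by (intro mult_left_mono le_powr) auto
    also have "((1 / 2 :: real) ^ j) powr d = ((1 / 2) powr d) ^ j"
      by (simp add: powr_realpow[symmetric] powr_powr mult.commute powr_power)
    finally show ?thesis .
  qed
  have lt1: "(1 / 2 :: real) powr d < 1"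
    using d by (simp add: powr_divide divide_simps)
  have "Cauchy ?u"
  proof (rule metric_CauchyI)
    fix e :: real assume e: "0 < e"
    have "(\<lambda>j. E * ((1 / 2) powr d) ^ j) \<longlonglongrightarrow> E * 0"
      using lt1 by (intro tendsto_mult LIMSEQ_realpow_zero tendsto_const) auto
    then have "\<forall>\<^sub>F j in sequentially. E * ((1 / 2) powr d) ^ j < e / 2"
      using e by (intro order_tendstoD(2)) auto
    then obtain N where N: "E * ((1 / 2) powr d) ^ N < e / 2"
      by (auto simp: eventually_sequentially)
    have "dist (?u m) (?u n) < e" if "N \<le> m" "N \<le> n" for m n
    proof -
      have "dist (?u m) (?u N) < e / 2" "dist (?u n) (?u N) < e / 2"
        using bound[OF that(1)] bound[OF that(2)] N by (simp_all add: dist_norm)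
      then show ?thesis
        by (rule dist_triangle_half_r[OF dist_commute_lessI dist_commute_lessI])
    qed
    then show "\<exists>N. \<forall>m\<ge>N. \<forall>n\<ge>N. dist (?u m) (?u n) < e"
      by blast
  qed
  then have "convergent ?u"
    by (simp add: Cauchy_convergent_iff)
  then show ?thesis
    unfolding representative_def by (simp add: convergent_LIMSEQ_iff)
qed

lemma representative_average:
  assumes l: "0 < l"
  shows "norm (representative x - average (cube x l) b) \<le> 2 ^ CARD('n) * M * geom * \<phi> x l"
proof (rule tendsto_upperbound)
  show "(\<lambda>k. norm (average (cube x ((1 / 2) ^ k)) b - average (cube x l) b))
      \<longlonglongrightarrow> norm (representative x - average (cube x l) b)"
    by (intro tendsto_intros average_tendsto)
  have "(\<lambda>k. (1 / 2 :: real) ^ k) \<longlonglongrightarrow> 0"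
    by (rule LIMSEQ_realpow_zero) auto
  then have "\<forall>\<^sub>F k in sequentially. (1 / 2) ^ k < l"
    using l by (rule order_tendstoD(2))
  then show "\<forall>\<^sub>F k in sequentially. norm (average (cube x ((1 / 2) ^ k)) b - average (cube x l) b)
      \<le> 2 ^ CARD('n) * M * geom * \<phi> x l"
    by eventually_elim (auto intro!: average_diff_concentric)
qed simp

text \<open>Here \<open>x\<close> need not be a corner of the large cube, which lets two points be
  compared through one common cube.\<close>

lemma representative_average_subcube:
  assumes l: "0 < l" and sub: "cube x l \<subseteq> cube a (2 * l)"
  shows "norm (representative x - average (cube a (2 * l)) b)
    \<le> 2 ^ CARD('n) * M * (geom + D) * \<phi> x l"
proof -
  have "norm (representative x - average (cube a (2 * l)) b)
      \<le> norm (representative x - average (cube x l) b)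
        + norm (average (cube x l) b - average (cube a (2 * l)) b)"
    by norm
  also have "\<dots> \<le> 2 ^ CARD('n) * M * geom * \<phi> x l + 2 ^ CARD('n) * M * \<phi> x (2 * l)"
    using l sub mem_cube_corner[OF l, of x]
    by (intro add_mono representative_average average_diff) auto
  also have "\<dots> \<le> 2 ^ CARD('n) * M * geom * \<phi> x l + 2 ^ CARD('n) * M * (D * \<phi> x l)"
    using M double[OF l] by (intro add_left_mono mult_left_mono) auto
  finally show ?thesis
    by (simp add: algebra_simps)
qed

lemma representative_diff:
  "norm (representative x - representative y) \<le> const * M * \<phi> x (norm (x - y))"
proof (cases "x = y")
  case True
  then show ?thesis
    using const_nonneg M nonneg by simp
next
  case False
  define l where "l = norm (x - y)"
  \<comment> \<open>With the componentwise minimum as corner, side \<open>2 * l\<close> suffices to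
    contain both corner cubes, because coordinates of \<open>x\<close> and \<open>y\<close> differ
    by at most \<open>l\<close>.\<close>
  define a :: "real ^ 'n" where "a = (\<chi> i. min (x $ i) (y $ i))"
  let ?P = "2 ^ CARD('n) * M * (geom + D)"
  have l: "0 < l"
    using False by (simp add: l_def)
  have dist: "\<bar>x $ i - y $ i\<bar> \<le> l" for i
    using component_le_norm_cart[of "x - y" i] by (simp add: l_def)
  have sub: "cube x l \<subseteq> cube a (2 * l)" "cube y l \<subseteq> cube a (2 * l)"
    by (rule cube_subsetI; use dist l in \<open>auto simp: a_def min_def abs_le_iff algebra_simps\<close>)+
  have P: "0 \<le> ?P"
    using M D geom_ge_1 by simp
  have "1 * l \<le> real CARD('n) * l"
    using l by (intro mult_right_mono) (auto simp: Suc_leI)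
  then have comp: "\<phi> y l \<le> K * \<phi> x l"
    using l by (intro comparable) (auto simp: l_def)
  have "norm (representative x - representative y)
      \<le> norm (representative x - average (cube a (2 * l)) b)
        + norm (representative y - average (cube a (2 * l)) b)"
    by norm
  also have "\<dots> \<le> ?P * \<phi> x l + ?P * \<phi> y l"
    by (intro add_mono representative_average_subcube l sub)
  also have "\<dots> \<le> ?P * \<phi> x l + ?P * (K * \<phi> x l)"
    using comp P by (intro add_left_mono mult_left_mono) auto
  also have "\<dots> = ?P * (1 + K) * \<phi> x l"
    by (simp add: algebra_simps)
  also have "\<dots> \<le> const * M * \<phi> x l"
  proof (intro mult_right_mono nonneg)
    have "?P * (1 + K) + 2 ^ CARD('n) * M * D * (1 + K) = const * M"
      by (simp add: const_def algebra_simps)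
    moreover have "0 \<le> 2 ^ CARD('n) * M * D * (1 + K)"
      using M D K by simp
    ultimately show "?P * (1 + K) \<le> const * M"
      by linarith
  qed
  finally show ?thesis
    by (simp add: l_def)
qed

text \<open>\<open>le_powr\<close> yields Hoelder continuity of the fixed order \<open>d\<close>;
  the continuity is needed for measurability.\<close>

lemma continuous_representative: "continuous_on UNIV representative"
proof (rule continuous_on_of_lip_bound)
  show "lip_bound (\<lambda>_. d) representative (const * M)"
    unfolding lip_bound_def
  proof (intro conjI allI)
    show "0 \<le> const * M"
      using const_nonneg M by simp
    show "norm (representative x - representative y) \<le> const * M * norm (x - y) powr d" for x y
    proof (cases "x = y")
      case False
      have "norm (representative x - representative y) \<le> const * M * \<phi> x (norm (x - y))"
        by (rule representative_diff)
      also have "\<dots> \<le> const * M * norm (x - y) powr d"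
        using False const_nonneg M by (intro mult_left_mono le_powr) auto
      finally show ?thesis .
    qed simp
  qed
qed (rule d)

lemma representative_AE: "AE x in lebesgue. b x = representative x"
proof -
  have mb [measurable]: "b \<in> borel_measurable lebesgue"
    by (rule locally_integrable_measurable[OF loc])
  have mr [measurable]: "representative \<in> borel_measurable lebesgue"
    by (rule measurable_completion) (use continuous_representative in \<open>simp add: borel_measurable_continuous_onI\<close>)
  define A where "A = M + 2 ^ CARD('n) * M * (geom + 2 * D)"
  have A: "0 \<le> A"
    using M D geom_ge_1 by (simp add: A_def)
  have "AE x in lebesgue. ennreal (norm (b x - representative x)) = 0"
  proof (rule AE_zero_of_small_on_cubes[OF _ d A])
    fix a :: "real ^ 'n" and l :: real assume l: "0 < l"
    let ?Q = "cube a l"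
    define P where "P = 2 ^ CARD('n) * M * (geom + 2 * D)"
    have P: "0 \<le> P"
      using M D geom_ge_1 by (simp add: P_def)
    have A_eq: "A = M + P"
      by (simp add: A_def P_def)
    have pt: "norm (representative y - average ?Q b) \<le> P * l powr d" if y: "y \<in> ?Q" for y
    proof -
      \<comment> \<open>The cube with corner \<open>y\<close> may stick out of \<open>?Q\<close>, so
        both are compared with the doubled cube, at a cost of \<open>D\<close> each.\<close>
      have sub: "cube y l \<subseteq> cube a (2 * l)" "?Q \<subseteq> cube a (2 * l)"
        by (rule cube_subsetI; use y l in \<open>auto simp: mem_cube add.commute\<close>)+
      have "norm (representative y - average ?Q b)
          \<le> norm (representative y - average (cube a (2 * l)) b)
            + norm (average ?Q b - average (cube a (2 * l)) b)"
        by norm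
      also have "\<dots> \<le> 2 ^ CARD('n) * M * (geom + D) * \<phi> y l + 2 ^ CARD('n) * M * \<phi> y (2 * l)"
        using l sub y by (intro add_mono representative_average_subcube average_diff) auto
      also have "\<dots> \<le> 2 ^ CARD('n) * M * (geom + D) * \<phi> y l + 2 ^ CARD('n) * M * (D * \<phi> y l)"
        using M double[OF l] by (intro add_left_mono mult_left_mono) auto
      also have "\<dots> = P * \<phi> y l"
        by (simp add: P_def algebra_simps)
      also have "\<dots> \<le> P * l powr d"
        by (intro mult_left_mono le_powr l P)
      finally show ?thesis .
    qed
    have "(\<integral>\<^sup>+x\<in>?Q. ennreal (norm (b x - representative x)) \<partial>lebesgue)
        \<le> (\<integral>\<^sup>+x. ennreal (norm (b x - average ?Q b)) * indicator ?Q x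
              + ennreal (P * l powr d) * indicator ?Q x \<partial>lebesgue)"
    proof (rule nn_integral_mono)
      fix x
      show "ennreal (norm (b x - representative x)) * indicator ?Q x
          \<le> ennreal (norm (b x - average ?Q b)) * indicator ?Q x
              + ennreal (P * l powr d) * indicator ?Q x"
      proof (cases "x \<in> ?Q")
        case True
        have "norm (b x - representative x)
            \<le> norm (b x - average ?Q b) + norm (representative x - average ?Q b)"
          by norm
        also have "\<dots> \<le> norm (b x - average ?Q b) + P * l powr d"
          using pt[OF True] by simp
        finally show ?thesis
          using True P by (simp add: ennreal_plus[symmetric] del: ennreal_plus)
      qed simp
    qed
    also have "\<dots> = (\<integral>\<^sup>+x\<in>?Q. ennreal (norm (b x - average ?Q b)) \<partial>lebesgue)
        + ennreal (P * l powr d) * ennreal (l ^ CARD('n))"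
      by (subst nn_integral_add)
        (auto simp: nn_integral_cmult_indicator emeasure_cube[OF less_imp_le[OF l]]
          simp del: emeasure_completion)
    also have "\<dots> \<le> ennreal (M * l ^ CARD('n) * l powr d) + ennreal (P * l powr d) * ennreal (l ^ CARD('n))"
    proof (rule add_right_mono)
      have "(\<integral>\<^sup>+x\<in>?Q. ennreal (norm (b x - average ?Q b)) \<partial>lebesgue)
          \<le> ennreal (M * l ^ CARD('n) * \<phi> a l)"
        by (intro osc l mem_cube_corner)
      also have "\<dots> \<le> ennreal (M * l ^ CARD('n) * l powr d)"
        using M l by (intro ennreal_leI mult_left_mono le_powr) auto
      finally show "(\<integral>\<^sup>+x\<in>?Q. ennreal (norm (b x - average ?Q b)) \<partial>lebesgue)
          \<le> ennreal (M * l ^ CARD('n) * l powr d)" .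
    qed
    also have "\<dots> = ennreal (A * l ^ CARD('n) * l powr d)"
      using M P l
      by (simp add: A_eq ennreal_mult'[symmetric] ennreal_plus[symmetric] algebra_simps
          del: ennreal_plus)
    finally show "(\<integral>\<^sup>+x\<in>?Q. ennreal (norm (b x - representative x)) \<partial>lebesgue)
        \<le> ennreal (A * l ^ CARD('n) * l powr d)" .
  qed measurable
  then show ?thesis
    by eventually_elim simp
qed

end

section \<open>The norm of the characteristic function of a cube\<close>

text \<open>Transfers the regularity of \<open>p\<close> to \<open>1 / p\<close>, the quantity that
  enters all orders.\<close>

lemma abs_inverse_diff_le:
  fixes a b :: real
  assumes "1 \<le> a" "1 \<le> b"
  shows "\<bar>1 / a - 1 / b\<bar> \<le> \<bar>a - b\<bar>"
proof -
  have "1 \<le> a * b"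
    using mult_mono[OF assms] assms by simp
  have "\<bar>1 / a - 1 / b\<bar> = \<bar>a - b\<bar> / (a * b)"
    using assms by (simp add: divide_simps abs_if)
  also have "\<dots> \<le> \<bar>a - b\<bar> / 1"
    using \<open>1 \<le> a * b\<close> by (intro divide_left_mono) auto
  finally show ?thesis by simp
qed

lemma ln_exp_add_ge_1: "0 \<le> t \<Longrightarrow> 1 \<le> ln (exp 1 + t :: real)"
  by (subst ln_ge_iff) (auto simp: add_pos_nonneg)

text \<open>\<open>m\<close> separates \<beta> uniformly from \<open>p\<close> and from
  \<open>p_inf\<close>. The bound \<open>p_inf \<le> p x\<close> is required everywhere; continuity
  extends it from almost every point.\<close>

locale log_holder_exponent =
  fixes p :: "real ^ 'n \<Rightarrow> real" and p_inf \<beta> C C_inf m :: real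
  assumes \<beta>: "1 < \<beta>" and \<beta>_less: "\<beta> < m" and p_ge: "m \<le> p x"
    and p_inf_ge: "m \<le> p_inf" and p_inf_le: "p_inf \<le> p x"
    and log: "\<bar>p x - p y\<bar> \<le> C / ln (exp 1 + 1 / norm (x - y))"
    and log_inf: "\<bar>p x - p_inf\<bar> \<le> C_inf / ln (exp 1 + norm x)"
    and C: "0 < C" and C_inf: "0 < C_inf"
begin

text \<open>One formula for two purposes: with \<open>e = n\<close> the exponents are
  \<open>n / p'\<close> at \<open>x\<close> and at infinity and give the norm of the characteristic
  function; with \<open>e = n / \<beta>\<close> they are the orders and give \<phi>.\<close>

definition scale :: "real \<Rightarrow> real ^ 'n \<Rightarrow> real \<Rightarrow> real" where
  "scale e x l = min (l powr (e - real CARD('n) / p x)) (l powr (e - real CARD('n) / p_inf))"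

lemma p_gt_1: "1 < p x" and p_inf_gt_1: "1 < p_inf"
  using \<beta> \<beta>_less p_ge[of x] p_inf_ge by auto

lemma exponent_le: "e - real CARD('n) / p_inf \<le> e - real CARD('n) / p x"
  using p_inf_gt_1 p_inf_le[of x] by (intro diff_left_mono divide_left_mono) auto

lemma scale_le_1: "0 < l \<Longrightarrow> l \<le> 1 \<Longrightarrow> scale e x l = l powr (e - real CARD('n) / p x)"
  unfolding scale_def by (intro min_absorb1 powr_mono') (use exponent_le in auto)

lemma scale_ge_1: "1 \<le> l \<Longrightarrow> scale e x l = l powr (e - real CARD('n) / p_inf)"
  unfolding scale_def by (intro min_absorb2 powr_mono) (use exponent_le in auto)

lemma scale_nonneg: "0 \<le> scale e x l"
  by (simp add: scale_def)

lemma scale_pos: "0 < l \<Longrightarrow> 0 < scale e x l"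
  by (simp add: scale_def)

lemma scale_shift:
  assumes "0 < l"
  shows "l powr a * scale e x l = scale (a + e) x l"
  unfolding scale_def using assms by (simp add: min_mult_distrib_left powr_add[symmetric] add_diff_eq)

text \<open>\<open>C * (ln n + 1)\<close> is the bound of \<open>ln_side_times_diff_le\<close>; the
  outer \<open>n\<close> comes from the exponents \<open>n / p x\<close>.\<close>

definition K :: real where
  "K = exp (real CARD('n) * (C * (ln (real CARD('n)) + 1)))"

lemma K_ge_1: "1 \<le> K"
proof -
  have "0 \<le> ln (real CARD('n))"
    by (simp add: Suc_leI)
  then show ?thesis
    using C unfolding K_def by simp
qed

text \<open>As \<open>1 / l \<le> n / norm (x - y)\<close>, the factor \<open>- ln l\<close> is at
  most \<open>ln n\<close> plus the logarithm in the log-Hoelder modulus. That logarithm is at least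
  1, so it absorbs \<open>ln n\<close> and then cancels.\<close>

lemma ln_side_times_diff_le:
  assumes l: "0 < l" "l \<le> 1" and xy: "norm (x - y) \<le> real CARD('n) * l"
  shows "- ln l * \<bar>p x - p y\<bar> \<le> C * (ln (real CARD('n)) + 1)"
proof (cases "x = y")
  case True
  have "0 \<le> ln (real CARD('n))"
    by (simp add: Suc_leI)
  then show ?thesis
    using True C by simp
next
  case False
  define h where "h = norm (x - y)"
  define L where "L = ln (exp 1 + 1 / h)"
  have h: "0 < h"
    using False by (simp add: h_def)
  have n: "0 \<le> ln (real CARD('n))"
    by (simp add: Suc_leI)
  have L: "1 \<le> L"
    unfolding L_def using h by (intro ln_exp_add_ge_1) simp
  have "1 / l \<le> real CARD('n) * (1 / h)"
    using l h xy by (simp add: h_def[symmetric] field_simps)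
  then have "ln (1 / l) \<le> ln (real CARD('n) * (1 / h))"
    using l h by (subst ln_le_cancel_iff) auto
  also have "\<dots> = ln (real CARD('n)) + ln (1 / h)"
    using h by (intro ln_mult_pos) auto
  also have "\<dots> \<le> ln (real CARD('n)) + L"
    unfolding L_def using h by (intro add_left_mono) (subst ln_le_cancel_iff, auto intro: add_pos_pos)
  also have "\<dots> \<le> ln (real CARD('n)) * L + L"
    using n L by (simp add: mult_le_cancel_left1)
  finally have "- ln l \<le> (ln (real CARD('n)) + 1) * L"
    using l by (simp add: ln_div algebra_simps)
  moreover have "\<bar>p x - p y\<bar> \<le> C / L"
    using log[of x y] by (simp add: L_def h_def)
  ultimately have "- ln l * \<bar>p x - p y\<bar> \<le> ((ln (real CARD('n)) + 1) * L) * (C / L)"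
    using l n L by (intro mult_mono) auto
  also have "\<dots> = C * (ln (real CARD('n)) + 1)"
    using L by simp
  finally show ?thesis .
qed

text \<open>For \<open>l \<le> 1\<close> the quotient of the two sides is a power of
  \<open>l\<close> whose exponent is controlled by log-Hoelder continuity; for \<open>l > 1\<close>
  the value of \<open>scale\<close> is independent of the point.\<close>

lemma scale_comparable:
  assumes l: "0 < l" and xy: "norm (x - y) \<le> real CARD('n) * l"
  shows "scale e y l \<le> K * scale e x l"
proof (cases "l \<le> 1")
  case True
  have "scale e y l = l powr (real CARD('n) * (1 / p x - 1 / p y)) * scale e x l"
    using True l by (simp add: scale_le_1 powr_add[symmetric] algebra_simps)
  also have "\<dots> \<le> K * scale e x l"
  proof (intro mult_right_mono scale_nonneg)
    have "(1 / p x - 1 / p y) * ln l \<le> \<bar>(1 / p x - 1 / p y) * ln l\<bar>"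
      by simp
    also have "\<dots> = - ln l * \<bar>1 / p x - 1 / p y\<bar>"
      using True l by (simp add: abs_mult)
    also have "\<dots> \<le> - ln l * \<bar>p x - p y\<bar>"
      using True l p_gt_1 by (intro mult_left_mono abs_inverse_diff_le) (auto intro: less_imp_le)
    also have "\<dots> \<le> C * (ln (real CARD('n)) + 1)"
      by (rule ln_side_times_diff_le[OF l True xy])
    finally show "l powr (real CARD('n) * (1 / p x - 1 / p y)) \<le> K"
      using l by (simp add: powr_def K_def mult_ac)
  qed
  finally show ?thesis .
next
  case False
  then show ?thesis
    using K_ge_1 scale_nonneg[of e x l] by (simp add: scale_ge_1 mult_le_cancel_right1)
qed

section \<open>Two-sided bounds for the Luxemburg norm\<close>

lemma luxemburg_integral:
  "(\<integral>\<^sup>+y. ennreal ((norm (indicat_real Q y) / t) powr conj_exponent p y) \<partial>lebesgue)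
    = (\<integral>\<^sup>+y\<in>Q. ennreal ((1 / t) powr conj_exponent p y) \<partial>lebesgue)"
  \<comment> \<open>Off \<open>Q\<close> the integrand is a power of 0, which \<open>powr\<close>
    sets to 0 for every exponent.\<close>
  by (intro nn_integral_cong) (auto simp: indicator_def)

lemma conj_exponent_gt_1: "1 < conj_exponent p x"
  using p_gt_1[of x] by (simp add: conj_exponent_def)

text \<open>Hence \<open>l powr (n - n / p y)\<close>, raised to the conjugate exponent at
  \<open>y\<close>, is the volume of the cube whatever \<open>y\<close> is.\<close>

lemma conj_exponent_mult: "(real CARD('n) - real CARD('n) / p x) * conj_exponent p x = real CARD('n)"
  using p_gt_1[of x] by (simp add: conj_exponent_def field_simps)

text \<open>If an admissible \<open>t\<close> were too small by a factor
  \<open>\<theta> > 1\<close>, the integrand would be at least \<theta> divided by the volume, and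
  the integral at least \<theta>. Only the first term of the minimum is used, so small and large
  cubes are treated alike.\<close>

lemma luxemburg_norm_cube_ge:
  assumes l: "0 < l" and x: "x \<in> cube a l"
  shows "ennreal (scale (real CARD('n)) x l / K)
    \<le> luxemburg_norm (conj_exponent p) (indicat_real (cube a l))"
  unfolding luxemburg_norm_def luxemburg_integral
proof (rule INF_greatest, clarify, rule ennreal_leI, rule ccontr)
  fix t :: real
  let ?n = "real CARD('n)"
  assume t: "0 < t"
    and le1: "(\<integral>\<^sup>+y\<in>cube a l. ennreal ((1 / t) powr conj_exponent p y) \<partial>lebesgue) \<le> 1"
    and "\<not> scale ?n x l / K \<le> t"
  define \<theta> where "\<theta> = scale ?n x l / (K * t)"
  have K: "0 < K"
    using K_ge_1 by simp
  have \<theta>: "1 < \<theta>"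
    using \<open>\<not> scale ?n x l / K \<le> t\<close> t K by (simp add: \<theta>_def field_simps)
  have pt: "\<theta> * l powr - ?n \<le> (1 / t) powr conj_exponent p y" if y: "y \<in> cube a l" for y
  proof -
    have "K * (t * \<theta>) = scale ?n x l"
      using K t by (simp add: \<theta>_def)
    also have "\<dots> \<le> K * scale ?n y l"
      using x y l by (intro scale_comparable norm_diff_cube) auto
    finally have "t * \<theta> \<le> scale ?n y l"
      using K by simp
    also have "\<dots> \<le> l powr (?n - ?n / p y)"
      by (simp add: scale_def)
    finally have "\<theta> * l powr - (?n - ?n / p y) \<le> 1 / t"
      using t l by (simp add: powr_minus_divide field_simps del: minus_diff_eq)
    then have "(\<theta> * l powr - (?n - ?n / p y)) powr conj_exponent p y \<le> (1 / t) powr conj_exponent p y"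
      using \<theta> conj_exponent_gt_1[of y] by (intro powr_mono2) auto
    moreover have "(\<theta> * l powr - (?n - ?n / p y)) powr conj_exponent p y
        = \<theta> powr conj_exponent p y * l powr - ?n"
      using \<theta> conj_exponent_mult[of y] by (simp add: powr_mult powr_powr del: minus_diff_eq)
    moreover have "\<theta> powr 1 \<le> \<theta> powr conj_exponent p y"
      using \<theta> conj_exponent_gt_1[of y] by (intro powr_mono) auto
    then have "\<theta> * l powr - ?n \<le> \<theta> powr conj_exponent p y * l powr - ?n"
      using \<theta> by (intro mult_right_mono) auto
    ultimately show ?thesis by linarith
  qed
  have "ennreal \<theta> = ennreal (\<theta> * l powr - ?n) * ennreal (l ^ CARD('n))"
    using l \<theta> by (simp add: ennreal_mult'[symmetric] powr_minus powr_realpow)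
  also have "\<dots> = (\<integral>\<^sup>+y\<in>cube a l. ennreal (\<theta> * l powr - ?n) \<partial>lebesgue)"
    by (subst nn_integral_cmult_indicator)
      (auto simp: emeasure_cube[OF less_imp_le[OF l]] simp del: emeasure_completion)
  also have "\<dots> \<le> (\<integral>\<^sup>+y\<in>cube a l. ennreal ((1 / t) powr conj_exponent p y) \<partial>lebesgue)"
    using pt by (intro nn_integral_mono) (auto simp: indicator_def intro!: ennreal_leI)
  finally have "ennreal \<theta> \<le> 1"
    using le1 by (rule order_trans)
  then show False
    using \<theta> by simp
qed

text \<open>With \<open>s = 1 - 1 / p_inf\<close>, one factor \<open>1 / s\<close> comes from the
  radius \<open>l powr s\<close> and the other from the bound \<open>1 / s\<close> on the conjugate
  exponent.\<close>

definition E :: real where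
  "E = exp (real CARD('n) * (C_inf / (1 - 1 / p_inf)\<^sup>2))"

definition K' :: real where
  "K' = K + E + 2 ^ CARD('n)"

lemma E_ge_1: "1 \<le> E"
  using C_inf by (simp add: E_def)

lemma luxemburg_norm_leI:
  assumes "0 < t"
    "(\<integral>\<^sup>+y\<in>Q. ennreal ((1 / t) powr conj_exponent p y) \<partial>lebesgue) \<le> 1"
  shows "luxemburg_norm (conj_exponent p) (indicat_real Q) \<le> ennreal t"
  unfolding luxemburg_norm_def luxemburg_integral using assms by (intro INF_lower) auto

text \<open>For \<open>l \<le> 1\<close>, \<open>scale\<close> at \<open>y\<close> has the exponent
  that belongs to \<open>y\<close> itself, so the integrand is at most the reciprocal volume. For
  \<open>l > 1\<close> it has the exponent at infinity, which calls for another argument.\<close>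

lemma luxemburg_norm_small_cube_le:
  assumes l: "0 < l" "l \<le> 1" and x: "x \<in> cube a l"
  shows "luxemburg_norm (conj_exponent p) (indicat_real (cube a l))
    \<le> ennreal (K * scale (real CARD('n)) x l)"
proof (rule luxemburg_norm_leI)
  let ?n = "real CARD('n)"
  define t where "t = K * scale ?n x l"
  show t: "0 < K * scale ?n x l"
    using K_ge_1 scale_pos[OF l(1)] by simp
  have pt: "(1 / t) powr conj_exponent p y \<le> l powr - ?n" if y: "y \<in> cube a l" for y
  proof -
    have "l powr (?n - ?n / p y) = scale ?n y l"
      using l by (simp add: scale_le_1)
    also have "\<dots> \<le> t"
      unfolding t_def using x y l by (intro scale_comparable norm_diff_cube) auto
    finally have "1 / t \<le> l powr - (?n - ?n / p y)"
      using t l unfolding t_def[symmetric] powr_minus by (simp add: field_simps)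
    then have "(1 / t) powr conj_exponent p y \<le> (l powr - (?n - ?n / p y)) powr conj_exponent p y"
      using t conj_exponent_gt_1[of y] unfolding t_def[symmetric] by (intro powr_mono2) auto
    also have "\<dots> = l powr - ?n"
      using conj_exponent_mult[of y] by (simp add: powr_powr del: minus_diff_eq)
    finally show ?thesis .
  qed
  have "(\<integral>\<^sup>+y\<in>cube a l. ennreal ((1 / t) powr conj_exponent p y) \<partial>lebesgue)
      \<le> (\<integral>\<^sup>+y\<in>cube a l. ennreal (l powr - ?n) \<partial>lebesgue)"
    using pt by (intro nn_integral_mono) (auto simp: indicator_def intro!: ennreal_leI)
  also have "\<dots> = ennreal (l powr - ?n) * ennreal (l ^ CARD('n))"
    by (subst nn_integral_cmult_indicator)
      (auto simp: emeasure_cube[OF less_imp_le[OF l(1)]] simp del: emeasure_completion)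
  also have "\<dots> = 1"
    using l by (simp add: ennreal_mult'[symmetric] powr_minus powr_realpow)
  finally show "(\<integral>\<^sup>+y\<in>cube a l. ennreal ((1 / (K * scale ?n x l)) powr conj_exponent p y) \<partial>lebesgue) \<le> 1"
    by (simp add: t_def)
qed

text \<open>On a large cube the exponent is close to its limit outside the ball of radius
  \<open>l powr (1 - 1 / p_inf)\<close>; this ball is so small that the crude bound on the integrand suffices there.\<close>

lemma luxemburg_norm_large_cube_le:
  assumes l: "1 \<le> l"
  shows "luxemburg_norm (conj_exponent p) (indicat_real (cube a l))
    \<le> ennreal ((E + 2 ^ CARD('n)) * scale (real CARD('n)) x l)"
proof (rule luxemburg_norm_leI)
  let ?n = "real CARD('n)"
  define s where "s = 1 - 1 / p_inf"
  define r where "r = l powr s"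
  define c where "c = E + 2 ^ CARD('n)"
  define t where "t = c * l powr (?n * s)"
  define B :: "(real ^ 'n) set" where "B = cube (\<chi> i. - r) (2 * r)"
  have s: "0 < s" "s < 1"
    using p_inf_gt_1 by (simp_all add: s_def)
  have r: "0 < r"
    using l by (simp add: r_def)
  have c: "1 \<le> c"
    using E_ge_1 by (simp add: c_def add_increasing2)
  have t_eq: "(E + 2 ^ CARD('n)) * scale ?n x l = t"
    using l by (simp add: t_def c_def scale_ge_1 s_def algebra_simps)
  have t: "0 < t"
    using c l by (simp add: t_def)
  then show "0 < (E + 2 ^ CARD('n)) * scale ?n x l"
    by (simp add: t_eq)
  \<comment> \<open>The first term covers the points far from the origin and integrates to
    \<open>E / c\<close> over the cube; the second covers the ball and integrates to
    \<open>2 ^ n / c\<close> over \<open>B\<close>. The choice of \<open>c\<close> makes the total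
    1.\<close>
  have pt: "(1 / t) powr conj_exponent p y
      \<le> (1 / c) * (E * l powr - ?n) + (1 / c) * l powr - (?n * s) * indicator B y" for y
  proof -
    define q where "q = conj_exponent p y"
    have q: "1 < q"
      using conj_exponent_gt_1 by (simp add: q_def)
    have "(1 / t) powr q = (1 / c) powr q * l powr - (?n * s * q)"
      using c l by (simp add: t_def powr_divide powr_mult powr_powr powr_minus_divide)
    also have "\<dots> \<le> (1 / c) powr 1 * l powr - (?n * s * q)"
      using c q by (intro mult_right_mono powr_mono') auto
    finally have *: "(1 / t) powr q \<le> (1 / c) * l powr - (?n * s * q)"
      using c by simp
    show ?thesis
    proof (cases "norm y < r")
      case True
      have "- r \<le> y $ i \<and> y $ i \<le> r" for i
        using component_le_norm_cart[of y i] True by auto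
      then have "y \<in> B"
        by (simp add: B_def mem_cube)
      \<comment> \<open>Near the origin the crude information \<open>q > 1\<close> is
        enough.\<close>
      have "?n * s * 1 \<le> ?n * s * q"
        using s q by (intro mult_left_mono) auto
      then have "l powr - (?n * s * q) \<le> l powr - (?n * s)"
        using l by (intro powr_mono) auto
      then have "(1 / c) * l powr - (?n * s * q) \<le> (1 / c) * l powr - (?n * s)"
        using c by (intro mult_left_mono) auto
      moreover have "0 \<le> (1 / c) * (E * l powr - ?n)"
        using c E_ge_1 by simp
      ultimately have "(1 / t) powr q
          \<le> (1 / c) * (E * l powr - ?n) + (1 / c) * l powr - (?n * s)"
        using * by linarith
      then show ?thesis
        using \<open>y \<in> B\<close> by (simp add: q_def)
    next
      case False
      define u where "u = 1 - 1 / p y"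
      have u: "s \<le> u" "u < 1" "u * q = 1"
        using p_inf_gt_1 p_inf_le[of y] p_gt_1[of y]
        by (auto simp: u_def s_def q_def conj_exponent_def intro!: divide_left_mono)
      have q_le: "q \<le> 1 / s"
        using u s q by (simp add: field_simps) (metis less_eq_real_def mult.commute mult_right_mono
          order.strict_trans zero_less_one)
      define L where "L = ln (exp 1 + norm y)"
      have L: "1 \<le> L"
        unfolding L_def by (intro ln_exp_add_ge_1) simp
      \<comment> \<open>Being outside the ball gives \<open>s * ln l \<le> L\<close>, so the decay
        \<open>C_inf / L\<close> of \<open>u - s\<close> compensates for the factor
        \<open>ln l\<close>.\<close>
      have "ln r \<le> L"
        unfolding L_def using r False by (subst ln_le_cancel_iff) (auto intro: add_pos_nonneg simp: add_increasing)
      then have sl: "s * ln l \<le> L"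
        using l by (simp add: r_def ln_powr)
      have "\<bar>1 / p y - 1 / p_inf\<bar> \<le> \<bar>p y - p_inf\<bar>"
        using p_gt_1[of y] p_inf_gt_1 by (intro abs_inverse_diff_le) auto
      also have "\<dots> \<le> C_inf / L"
        using log_inf[of y] by (simp add: L_def)
      finally have "u - s \<le> C_inf / L"
        by (simp add: u_def s_def abs_le_iff)
      then have "(u - s) * (s * ln l) \<le> C_inf / L * L"
        using u s l sl L C_inf by (intro mult_mono) auto
      then have "(u - s) * ln l \<le> C_inf / s"
        using L s by (simp add: field_simps)
      then have "(u - s) * ln l * q \<le> C_inf / s * (1 / s)"
        using u s l q q_le C_inf by (intro mult_mono) auto
      then have "(1 - s * q) * ln l \<le> C_inf / s\<^sup>2"
        using u(3) by (simp add: algebra_simps power2_eq_square) (metis distrib_left mult.assoc mult.commute mult_1)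
      then have "?n * ((1 - s * q) * ln l) \<le> ?n * (C_inf / s\<^sup>2)"
        by (intro mult_left_mono) auto
      then have "l powr (?n * (1 - s * q)) \<le> E"
        using l by (simp add: powr_def E_def s_def mult.assoc)
      then have "l powr (?n * (1 - s * q)) * l powr - ?n \<le> E * l powr - ?n"
        by (intro mult_right_mono) auto
      then have "l powr - (?n * s * q) \<le> E * l powr - ?n"
        by (simp add: powr_add[symmetric] algebra_simps)
      then have "(1 / c) * l powr - (?n * s * q) \<le> (1 / c) * (E * l powr - ?n)"
        using c by (intro mult_left_mono) auto
      moreover have "0 \<le> (1 / c) * l powr - (?n * s) * indicator B y"
        using c by simp
      ultimately show ?thesis
        using * by (simp add: q_def)
    qed
  qed
  have nonneg: "0 \<le> (1 / c) * (E * l powr - ?n)" "0 \<le> (1 / c) * l powr - (?n * s)"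
    using c E_ge_1 by auto
  have "(\<integral>\<^sup>+y\<in>cube a l. ennreal ((1 / t) powr conj_exponent p y) \<partial>lebesgue)
      \<le> (\<integral>\<^sup>+y. ennreal ((1 / c) * (E * l powr - ?n)) * indicator (cube a l) y
          + ennreal ((1 / c) * l powr - (?n * s)) * indicator B y \<partial>lebesgue)"
  proof (rule nn_integral_mono)
    fix y
    have "ennreal ((1 / t) powr conj_exponent p y) \<le> ennreal ((1 / c) * (E * l powr - ?n))
        + ennreal ((1 / c) * l powr - (?n * s)) * indicator B y"
      using ennreal_leI[OF pt[of y]] nonneg by (auto simp: indicator_def split: if_splits)
    then show "ennreal ((1 / t) powr conj_exponent p y) * indicator (cube a l) y
      \<le> ennreal ((1 / c) * (E * l powr - ?n)) * indicator (cube a l) y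
          + ennreal ((1 / c) * l powr - (?n * s)) * indicator B y"
      by (auto simp: indicator_def split: if_splits)
  qed
  also have "\<dots> = ennreal ((1 / c) * (E * l powr - ?n)) * ennreal (l ^ CARD('n))
      + ennreal ((1 / c) * l powr - (?n * s)) * ennreal ((2 * r) ^ CARD('n))"
    using l r unfolding B_def
    by (subst nn_integral_add)
      (auto simp: nn_integral_cmult_indicator emeasure_cube simp del: emeasure_completion)
  also have "\<dots> = ennreal (((1 / c) * (E * l powr - ?n)) * l ^ CARD('n)
      + ((1 / c) * l powr - (?n * s)) * (2 * r) ^ CARD('n))"
    using l r nonneg by (simp only: ennreal_mult'[symmetric] ennreal_plus[symmetric] zero_le_power
      mult_nonneg_nonneg less_imp_le zero_less_numeral mult_pos_pos zero_le_one order_trans[OF zero_le_one])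
  \<comment> \<open>The radius \<open>l powr s\<close> is chosen so that \<open>r ^ n\<close>
    exactly cancels \<open>l powr - (n * s)\<close>.\<close>
  also have "((1 / c) * (E * l powr - ?n)) * l ^ CARD('n)
      + ((1 / c) * l powr - (?n * s)) * (2 * r) ^ CARD('n) = (1 / c) * (E + 2 ^ CARD('n))"
  proof -
    have "l powr - ?n * l ^ CARD('n) = 1"
      using l by (simp add: powr_minus powr_realpow)
    moreover have "r ^ CARD('n) = l powr (?n * s)"
      using l by (simp add: r_def powr_realpow[symmetric] powr_powr mult.commute)
    then have "l powr - (?n * s) * r ^ CARD('n) = 1"
      using l by (simp add: powr_minus)
    moreover have "((1 / c) * (E * l powr - ?n)) * l ^ CARD('n)
        + ((1 / c) * l powr - (?n * s)) * (2 * r) ^ CARD('n)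
      = (1 / c) * (E * (l powr - ?n * l ^ CARD('n)) + 2 ^ CARD('n) * (l powr - (?n * s) * r ^ CARD('n)))"
      by (simp add: power_mult_distrib add_divide_distrib mult_ac)
    ultimately show ?thesis
      by simp
  qed
  also have "\<dots> = 1"
    using c by (simp add: c_def)
  finally show "(\<integral>\<^sup>+y\<in>cube a l. ennreal ((1 / ((E + 2 ^ CARD('n)) * scale ?n x l)) powr
      conj_exponent p y) \<partial>lebesgue) \<le> 1"
    by (simp add: t_eq)
qed

lemma luxemburg_norm_cube_le:
  assumes l: "0 < l" and x: "x \<in> cube a l"
  shows "luxemburg_norm (conj_exponent p) (indicat_real (cube a l))
    \<le> ennreal (K' * scale (real CARD('n)) x l)"
proof (cases "l \<le> 1")
  case True
  have "K * scale (real CARD('n)) x l \<le> K' * scale (real CARD('n)) x l"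
    using E_ge_1 by (intro mult_right_mono scale_nonneg) (simp add: K'_def)
  then show ?thesis
    using luxemburg_norm_small_cube_le[OF l True x] by (meson ennreal_leI order_trans)
next
  case False
  have "(E + 2 ^ CARD('n)) * scale (real CARD('n)) x l \<le> K' * scale (real CARD('n)) x l"
    using K_ge_1 by (intro mult_right_mono scale_nonneg) (simp add: K'_def)
  then show ?thesis
    using luxemburg_norm_large_cube_le[of l a x] False by (meson ennreal_leI order_trans linear)
qed

section \<open>The denominator of the integral seminorm\<close>

definition weight :: "(real ^ 'n) set \<Rightarrow> ennreal" where
  "weight Q = ennreal (measure lebesgue Q powr (1 / \<beta>)) * luxemburg_norm (conj_exponent p) (indicat_real Q)"

lemma integral_Lip_norm_eq:
  "integral_Lip_norm \<beta> p b
    = (SUP Q\<in>cubes. (\<integral>\<^sup>+x\<in>Q. ennreal (norm (b x - average Q b)) \<partial>lebesgue) / weight Q)"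
  by (simp add: integral_Lip_norm_def weight_def)

definition \<phi> :: "real ^ 'n \<Rightarrow> real \<Rightarrow> real" where
  "\<phi> = scale (real CARD('n) / \<beta>)"

text \<open>The exponents \<open>n / \<beta>\<close> and \<open>n - n / p x\<close> add up to
  \<open>n\<close> plus the order at \<open>x\<close>, and likewise at infinity.\<close>

lemma measure_powr_times_scale:
  fixes a :: "real ^ 'n"
  assumes l: "0 < l"
  shows "measure lebesgue (cube a l) powr (1 / \<beta>) * scale (real CARD('n)) x l
    = l ^ CARD('n) * \<phi> x l"
proof -
  have "measure lebesgue (cube a l) powr (1 / \<beta>) = l powr (real CARD('n) / \<beta>)"
    using l by (simp add: measure_cube powr_realpow[symmetric] powr_powr)
  moreover have "l ^ CARD('n) = l powr real CARD('n)"
    using l by (simp add: powr_realpow)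
  ultimately show ?thesis
    using l by (simp add: \<phi>_def scale_shift add.commute)
qed

lemma weight_ge:
  assumes "0 < l" "x \<in> cube a l"
  shows "ennreal (l ^ CARD('n) * \<phi> x l) \<le> ennreal K * weight (cube a l)"
proof -
  let ?m = "measure lebesgue (cube a l) powr (1 / \<beta>)"
  have K: "0 < K"
    using K_ge_1 by simp
  have "ennreal (l ^ CARD('n) * \<phi> x l) = ennreal (K * (?m * (scale (real CARD('n)) x l / K)))"
    using K assms(1) by (simp add: measure_powr_times_scale[symmetric, where a = a])
  also have "\<dots> = ennreal K * (ennreal ?m * ennreal (scale (real CARD('n)) x l / K))"
    using K by (simp only: ennreal_mult' powr_ge_zero less_imp_le)
  also have "\<dots> \<le> ennreal K * weight (cube a l)"
    unfolding weight_def by (intro mult_left_mono luxemburg_norm_cube_ge assms) auto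
  finally show ?thesis .
qed

lemma weight_pos:
  assumes l: "0 < l"
  shows "0 < weight (cube a l)"
proof (rule ccontr)
  assume "\<not> 0 < weight (cube a l)"
  then have "weight (cube a l) = 0"
    by (simp add: zero_less_iff_neq_zero)
  moreover have "a \<in> cube a l"
    using l by (simp add: mem_cube)
  ultimately have "l ^ CARD('n) * \<phi> a l \<le> 0"
    using weight_ge[OF l, of a a] by (simp add: ennreal_eq_0_iff)
  moreover have "0 < l ^ CARD('n) * \<phi> a l"
    using l scale_pos[OF l] by (simp add: \<phi>_def)
  ultimately show False
    by linarith
qed

lemma weight_le:
  assumes "0 < l" "x \<in> cube a l"
  shows "weight (cube a l) \<le> ennreal (K' * (l ^ CARD('n) * \<phi> x l))"
proof -
  let ?m = "measure lebesgue (cube a l) powr (1 / \<beta>)"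
  have "weight (cube a l) \<le> ennreal ?m * ennreal (K' * scale (real CARD('n)) x l)"
    unfolding weight_def by (intro mult_left_mono luxemburg_norm_cube_le assms) auto
  also have "\<dots> = ennreal (?m * (K' * scale (real CARD('n)) x l))"
    by (simp only: ennreal_mult' powr_ge_zero)
  also have "?m * (K' * scale (real CARD('n)) x l) = K' * (l ^ CARD('n) * \<phi> x l)"
    using assms(1) by (simp add: measure_powr_times_scale[symmetric, where a = a])
  finally show ?thesis .
qed

section \<open>Comparison of the two seminorms\<close>

definition order :: "real ^ 'n \<Rightarrow> real" where
  "order x = real CARD('n) / \<beta> - real CARD('n) / p x"

definition order_inf :: real where
  "order_inf = real CARD('n) / \<beta> - real CARD('n) / p_inf"

lemma order_inf_pos: "0 < order_inf"
  using \<beta> \<beta>_less p_inf_ge by (simp add: order_inf_def divide_strict_left_mono)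

lemma order_inf_le: "order_inf \<le> order x"
  unfolding order_def order_inf_def by (rule exponent_le)

lemma order_pos: "0 < order x"
  using order_inf_pos order_inf_le[of x] by linarith

lemma order_le: "order x \<le> real CARD('n)"
proof -
  have "real CARD('n) / \<beta> \<le> real CARD('n) / 1"
    using \<beta> by (intro divide_left_mono) auto
  moreover have "0 \<le> real CARD('n) / p x"
    using p_gt_1[of x] by simp
  ultimately show ?thesis
    by (simp add: order_def)
qed

lemma \<phi>_eq: "\<phi> x l = min (l powr order x) (l powr order_inf)"
  by (simp add: \<phi>_def scale_def order_def order_inf_def)

text \<open>Both orders lie between \<open>order_inf\<close> and \<open>n\<close>. So halving
  \<open>l\<close> multiplies each power by at most \<open>2 powr - order_inf\<close>, doubling
  costs at most \<open>2 powr n\<close>, and the minimum inherits both bounds.\<close>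

lemma growth_function_\<phi>: "growth_function \<phi> order_inf K (2 powr real CARD('n))"
proof
  fix x y :: "real ^ 'n" and l :: real
  show "0 < order_inf"
    by (rule order_inf_pos)
  show "0 \<le> \<phi> x l"
    by (simp add: \<phi>_def scale_nonneg)
  show "\<phi> x (l / 2) \<le> 2 powr - order_inf * \<phi> x l" if "0 < l"
  proof -
    have "(l / 2) powr order x = 2 powr - order x * l powr order x"
      using that by (simp add: powr_divide powr_minus divide_simps)
    also have "\<dots> \<le> 2 powr - order_inf * l powr order x"
      using order_inf_le[of x] by (intro mult_right_mono powr_mono) auto
    finally have "(l / 2) powr order x \<le> 2 powr - order_inf * l powr order x" .
    moreover have "(l / 2) powr order_inf = 2 powr - order_inf * l powr order_inf"
      using that by (simp add: powr_divide powr_minus divide_simps)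
    ultimately show ?thesis
      unfolding \<phi>_eq min_mult_distrib_left by (auto simp: min_le_iff_disj)
  qed
  show "\<phi> x (2 * l) \<le> 2 powr real CARD('n) * \<phi> x l" if "0 < l"
  proof -
    have "(2 * l) powr e \<le> 2 powr real CARD('n) * l powr e" if "e \<le> real CARD('n)" for e
      using that \<open>0 < l\<close> unfolding powr_mult by (intro mult_right_mono powr_mono) auto
    from this[OF order_le[of x]] this[of order_inf] order_le[of x] order_inf_le[of x]
    show ?thesis
      unfolding \<phi>_eq min_mult_distrib_left by (auto simp: min_le_iff_disj)
  qed
  show "\<phi> y l \<le> K * \<phi> x l" if "0 < l" "norm (x - y) \<le> real CARD('n) * l"
    unfolding \<phi>_def by (rule scale_comparable[OF that])
  show "\<phi> x l \<le> l powr order_inf"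
    by (simp add: \<phi>_eq)
  show "0 \<le> (2::real) powr real CARD('n)" "0 \<le> K"
    using K_ge_1 by auto
qed

text \<open>The upper bound on \<open>weight\<close> turns the seminorm bound into controlled
  oscillation with \<open>M = K' * N\<close>. Quantifying \<open>c\<close> before \<open>b\<close>
  and \<open>N\<close> makes the constant uniform in \<open>b\<close>.\<close>

lemma lip_bound_of_integral_Lip_norm:
  "\<exists>c\<ge>0. \<forall>(b :: real ^ 'n \<Rightarrow> 'a::euclidean_space) N. 0 \<le> N \<longrightarrow> locally_integrable b \<longrightarrow>
     integral_Lip_norm \<beta> p b \<le> ennreal N \<longrightarrow>
     (\<exists>b'. (AE x in lebesgue. b x = b' x) \<and> lip_bound order b' (c * N))"
proof -
  interpret growth_function \<phi> order_inf K "2 powr real CARD('n)"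
    by (rule growth_function_\<phi>)
  have K': "0 \<le> K'"
    using K_ge_1 E_ge_1 by (simp add: K'_def)
  show ?thesis
  proof (intro exI[of _ "const * K'"] conjI allI impI)
    show "0 \<le> const * K'"
      using const_nonneg K' by simp
  next
    fix b :: "real ^ 'n \<Rightarrow> 'a" and N :: real
    assume N: "0 \<le> N" and loc: "locally_integrable b"
      and norm_le: "integral_Lip_norm \<beta> p b \<le> ennreal N"
    interpret controlled_oscillation \<phi> order_inf K "2 powr real CARD('n)" b "K' * N"
    proof
      show "locally_integrable b"
        by (rule loc)
      show "0 \<le> K' * N"
        using K' N by simp
      fix a x :: "real ^ 'n" and l :: real
      assume l: "0 < l" and x: "x \<in> cube a l"
      let ?I = "\<integral>\<^sup>+y\<in>cube a l. ennreal (norm (b y - average (cube a l) b)) \<partial>lebesgue"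
      have "weight (cube a l) \<noteq> 0"
        using weight_pos[OF l, of a] by simp
      moreover have "weight (cube a l) \<noteq> top"
        using weight_le[OF l x] by (auto simp: top_unique)
      \<comment> \<open>Cancellation in \<open>ennreal\<close> requires the weight to be neither 0
        nor infinite.\<close>
      ultimately have "?I = ?I / weight (cube a l) * weight (cube a l)"
        by (simp add: ennreal_divide_times ennreal_divide_self less_top)
      also have "\<dots> \<le> ennreal N * ennreal (K' * (l ^ CARD('n) * \<phi> x l))"
      proof (rule mult_mono)
        have "?I / weight (cube a l) \<le> integral_Lip_norm \<beta> p b"
          unfolding integral_Lip_norm_eq using l by (intro SUP_upper) (auto simp: cubes_eq)
        then show "?I / weight (cube a l) \<le> ennreal N"
          using norm_le by (rule order_trans)
        show "weight (cube a l) \<le> ennreal (K' * (l ^ CARD('n) * \<phi> x l))"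
          by (rule weight_le[OF l x])
      qed simp_all
      also have "\<dots> = ennreal (N * (K' * (l ^ CARD('n) * \<phi> x l)))"
        using N by (rule ennreal_mult'[symmetric])
      also have "N * (K' * (l ^ CARD('n) * \<phi> x l)) = K' * N * l ^ CARD('n) * \<phi> x l"
        by simp
      finally show "?I \<le> ennreal (K' * N * l ^ CARD('n) * \<phi> x l)" .
    qed
    have "lip_bound order representative (const * K' * N)"
      unfolding lip_bound_def
    proof (intro conjI allI)
      show "0 \<le> const * K' * N"
        using const_nonneg K' N by simp
      fix x y
      have "norm (representative x - representative y) \<le> const * (K' * N) * \<phi> x (norm (x - y))"
        by (rule representative_diff)
      also have "\<dots> \<le> const * (K' * N) * norm (x - y) powr order x"
        using const_nonneg K' N by (intro mult_left_mono) (auto simp: \<phi>_eq)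
      finally show "norm (representative x - representative y) \<le> const * K' * N * norm (x - y) powr order x"
        by (simp add: mult.assoc)
    qed
    then show "\<exists>b'. (AE x in lebesgue. b x = b' x) \<and> lip_bound order b' (const * K' * N)"
      using representative_AE by blast
  qed
qed

section \<open>From the pointwise bound to the integral bound\<close>

definition K_far :: real where
  "K_far = exp (real CARD('n) * (2 * C_inf))"

lemma K_far_ge_1: "1 \<le> K_far"
  using C_inf by (simp add: K_far_def)

text \<open>One of two opposite corners has norm at least \<open>l / 2\<close>.\<close>

lemma cube_point_far_from_origin:
  fixes a :: "real ^ 'n"
  assumes l: "0 < l"
  obtains x where "x \<in> cube a l" "l / 2 \<le> norm x"
proof (cases "l / 2 \<le> norm a")
  case True
  then show ?thesis
    using that[of a] l by (simp add: mem_cube)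
next
  case False
  fix i :: 'n
  let ?x = "(\<chi> i. a $ i + l) :: real ^ 'n"
  have "\<bar>a $ i\<bar> < l / 2"
    using component_le_norm_cart[of a i] False by simp
  then have "l / 2 \<le> \<bar>?x $ i\<bar>"
    by simp
  also have "\<dots> \<le> norm ?x"
    by (rule component_le_norm_cart)
  finally show ?thesis
    using that[of ?x] l by (simp add: mem_cube)
qed

text \<open>For \<open>l > 1\<close> the excess \<open>order x - order_inf\<close> is at most
  \<open>n * C_inf / ln (exp 1 + norm x)\<close>, and \<open>ln l\<close> is at most twice that
  logarithm; the product of the two is bounded.\<close>

lemma powr_order_le_far:
  assumes l: "0 < l" and x: "l / 2 \<le> norm x"
  shows "l powr order x \<le> K_far * \<phi> x l"
proof (cases "l \<le> 1")
  case True
  have "\<phi> x l = l powr order x"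
    using True l by (simp add: \<phi>_def scale_le_1 order_def)
  then show ?thesis
    using mult_right_mono[OF K_far_ge_1, of "l powr order x"] by simp
next
  case False
  define L where "L = ln (exp 1 + norm x)"
  have L: "1 \<le> L"
    unfolding L_def by (intro ln_exp_add_ge_1) simp
  have exp: "2 \<le> exp (1::real)"
    using exp_ge_add_one_self[of 1] by simp
  \<comment> \<open>The bound \<open>2 \<le> exp 1\<close> absorbs the 2 of \<open>l / 2\<close>;
    the square becomes the factor 2 in \<open>K_far\<close>.\<close>
  have "2 * (l / 2) \<le> (exp 1 + norm x) * (exp 1 + norm x)"
    using exp x l by (intro mult_mono) auto
  then have "ln l \<le> ln ((exp 1 + norm x) * (exp 1 + norm x))"
    using l by (subst ln_le_cancel_iff) (auto intro: add_pos_nonneg mult_pos_pos)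
  also have "\<dots> = 2 * L"
    unfolding L_def by (subst ln_mult_pos) (auto intro: add_pos_nonneg)
  finally have ln_le: "ln l \<le> 2 * L" .
  have "\<bar>1 / p x - 1 / p_inf\<bar> \<le> \<bar>p x - p_inf\<bar>"
    using p_gt_1[of x] p_inf_gt_1 by (intro abs_inverse_diff_le) auto
  also have "\<dots> \<le> C_inf / L"
    using log_inf[of x] by (simp add: L_def)
  finally have "1 / p_inf - 1 / p x \<le> C_inf / L"
    by simp
  moreover have "0 \<le> C_inf / L"
    using C_inf L by simp
  ultimately have "(1 / p_inf - 1 / p x) * ln l \<le> C_inf / L * (2 * L)"
    using ln_le False by (intro mult_mono) auto
  also have "\<dots> = 2 * C_inf"
    using L by simp
  finally have "real CARD('n) * ((1 / p_inf - 1 / p x) * ln l) \<le> real CARD('n) * (2 * C_inf)"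
    by (intro mult_left_mono) auto
  then have "l powr (order x - order_inf) \<le> K_far"
    using l by (simp add: powr_def K_far_def order_def order_inf_def algebra_simps)
  then have "l powr (order x - order_inf) * l powr order_inf \<le> K_far * l powr order_inf"
    by (intro mult_right_mono) auto
  moreover have "\<phi> x l = l powr order_inf"
    using False by (simp add: \<phi>_def scale_ge_1 order_inf_def)
  ultimately show ?thesis
    by (simp add: powr_add[symmetric])
qed

text \<open>\<open>n powr n\<close> bounds the power of the diameter factor \<open>n\<close>, as
  orders are at most \<open>n\<close>; \<open>K_far\<close> pays for the far point, \<open>K\<close>
  for the weight, and 2 for replacing \<open>b x\<close> by the average.\<close>

definition K_osc :: real where
  "K_osc = 2 * real CARD('n) powr real CARD('n) * K_far * K"

lemma K_osc_nonneg: "0 \<le> K_osc"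
  using K_far_ge_1 K_ge_1 by (simp add: K_osc_def)

text \<open>Every value on the cube is compared with the value at one far point \<open>x\<close>,
  placed first in the Lipschitz inequality so that its exponent applies. The average is then equally
  close to \<open>b x\<close>.\<close>

lemma integral_Lip_norm_le:
  fixes b :: "real ^ 'n \<Rightarrow> 'a::euclidean_space"
  assumes b: "lip_bound order b B"
  shows "integral_Lip_norm \<beta> p b \<le> ennreal (K_osc * B)"
  unfolding integral_Lip_norm_eq
proof (rule SUP_least)
  fix Q :: "(real ^ 'n) set"
  assume "Q \<in> cubes"
  then obtain a l where Q: "Q = cube a l" and l: "0 < l"
    by (auto simp: cubes_eq)
  obtain x where x: "x \<in> cube a l" "l / 2 \<le> norm x"
    using cube_point_far_from_origin[OF l] .
  let ?n = "real CARD('n)"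
  define R where "R = B * (?n powr ?n * K_far * \<phi> x l)"
  have n: "1 \<le> ?n"
    by (simp add: Suc_leI)
  have B: "0 \<le> B"
    using b by (simp add: lip_bound_def)
  have \<phi>: "0 < \<phi> x l"
    using scale_pos[OF l] by (simp add: \<phi>_def)
  have R: "0 \<le> R"
    using B \<phi> K_far_ge_1 by (simp add: R_def)
  have pt: "norm (b y - b x) \<le> R" if y: "y \<in> cube a l" for y
  proof -
    have "norm (b y - b x) \<le> B * norm (x - y) powr order x"
      using b by (metis lip_bound_def norm_minus_commute)
    also have "\<dots> \<le> B * (?n * l) powr order x"
      using B order_pos[of x] norm_diff_cube[OF x(1) y] by (intro mult_left_mono powr_mono2) auto
    also have "(?n * l) powr order x = ?n powr order x * l powr order x"
      using l by (simp add: powr_mult)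
    also have "B * \<dots> \<le> B * (?n powr ?n * (K_far * \<phi> x l))"
      using B n order_le[of x] powr_order_le_far[OF l x(2)]
      by (intro mult_left_mono mult_mono powr_mono) auto
    finally show ?thesis
      by (simp add: R_def mult.assoc)
  qed
  have const: "(\<integral>\<^sup>+y\<in>cube a l. ennreal r \<partial>lebesgue) = ennreal (r * l ^ CARD('n))" if "0 \<le> r" for r
    using that l by (subst nn_integral_cmult_indicator)
      (auto simp: emeasure_cube ennreal_mult' simp del: emeasure_completion)
  have "locally_integrable b"
    using b order_pos by (intro locally_integrable_continuous continuous_on_of_lip_bound)
  then have int: "b absolutely_integrable_on cube a l"
    using compact_cube unfolding locally_integrable_def by blast
  have "ennreal (l ^ CARD('n) * norm (average (cube a l) b - b x))
      \<le> (\<integral>\<^sup>+y\<in>cube a l. ennreal (norm (b y - b x)) \<partial>lebesgue)"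
    by (rule norm_average_diff_le[OF int l])
  also have "\<dots> \<le> (\<integral>\<^sup>+y\<in>cube a l. ennreal R \<partial>lebesgue)"
    using pt by (intro nn_integral_mono) (auto simp: indicator_def intro!: ennreal_leI)
  also have "\<dots> = ennreal (l ^ CARD('n) * R)"
    using R by (simp add: const mult.commute)
  finally have avg: "norm (average (cube a l) b - b x) \<le> R"
    using R l by (simp add: ennreal_le_iff)
  have "(\<integral>\<^sup>+y\<in>cube a l. ennreal (norm (b y - average (cube a l) b)) \<partial>lebesgue)
      \<le> (\<integral>\<^sup>+y\<in>cube a l. ennreal (2 * R) \<partial>lebesgue)"
  proof (rule nn_integral_mono)
    fix y
    have "norm (b y - average (cube a l) b) \<le> 2 * R" if "y \<in> cube a l"
    proof -
      have "norm (b y - average (cube a l) b) \<le> norm (b y - b x) + norm (average (cube a l) b - b x)"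
        by norm
      then show ?thesis
        using pt[OF that] avg by linarith
    qed
    then show "ennreal (norm (b y - average (cube a l) b)) * indicator (cube a l) y
        \<le> ennreal (2 * R) * indicator (cube a l) y"
      by (auto simp: indicator_def intro!: ennreal_leI)
  qed
  also have "\<dots> = ennreal (2 * R * l ^ CARD('n))"
    using R by (intro const) simp
  also have "2 * R * l ^ CARD('n)
      = B * (2 * ?n powr ?n * K_far) * (l ^ CARD('n) * \<phi> x l)"
    by (simp add: R_def)
  also have "ennreal \<dots> = ennreal (B * (2 * ?n powr ?n * K_far)) * ennreal (l ^ CARD('n) * \<phi> x l)"
    using B K_far_ge_1 by (intro ennreal_mult') auto
  also have "\<dots> \<le> ennreal (B * (2 * ?n powr ?n * K_far)) * (ennreal K * weight (cube a l))"
    by (intro mult_left_mono weight_ge l x) simp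
  also have "\<dots> = ennreal (B * (2 * ?n powr ?n * K_far) * K) * weight (cube a l)"
    using B K_far_ge_1 K_ge_1 by (simp add: ennreal_mult' mult.assoc)
  also have "B * (2 * ?n powr ?n * K_far) * K = K_osc * B"
    by (simp add: K_osc_def)
  finally have le: "(\<integral>\<^sup>+y\<in>cube a l. ennreal (norm (b y - average (cube a l) b)) \<partial>lebesgue)
      \<le> weight (cube a l) * ennreal (K_osc * B)"
    by (simp add: mult.commute)
  show "(\<integral>\<^sup>+y\<in>Q. ennreal (norm (b y - average Q b)) \<partial>lebesgue) / weight Q \<le> ennreal (K_osc * B)"
    unfolding Q by (rule divide_le_posI_ennreal[OF weight_pos[OF l] le])
qed

end

section \<open>From the hypotheses of the theorem to those of the locale\<close>

lemma log_holder_ge_of_AE_ge: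
  fixes p :: "real ^ 'n \<Rightarrow> real"
  assumes C: "0 < C" and log: "\<And>x y. \<bar>p x - p y\<bar> \<le> C / ln (exp 1 + 1 / norm (x - y))"
    and ae: "AE x in lebesgue. r \<le> p x"
  shows "r \<le> p x"
proof (rule ccontr)
  assume "\<not> r \<le> p x"
  define \<epsilon> where "\<epsilon> = r - p x"
  \<comment> \<open>\<open>norm (x - y) < h\<close> makes the logarithm exceed
    \<open>C / \<epsilon>\<close>, so \<open>p < r\<close> on a whole ball, which is not
    null.\<close>
  define h where "h = 1 / exp (C / \<epsilon>)"
  have \<epsilon>: "0 < \<epsilon>" and h: "0 < h"
    using \<open>\<not> r \<le> p x\<close> by (simp_all add: \<epsilon>_def h_def)
  have "p y < r" if y: "y \<in> ball x h" for y
  proof (cases "y = x")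
    case True
    then show ?thesis
      using \<epsilon> by (simp add: \<epsilon>_def)
  next
    case False
    define u where "u = norm (x - y)"
    have u: "0 < u" "u < h"
      using y False by (simp_all add: u_def dist_norm)
    have "exp (C / \<epsilon>) < 1 / u"
      using u h by (simp add: h_def field_simps)
    then have "exp (C / \<epsilon>) < exp 1 + 1 / u"
      using exp_gt_zero[of "1::real"] by linarith
    then have "C / \<epsilon> < ln (exp 1 + 1 / u)"
      using u by (metis exp_gt_zero ln_exp ln_less_cancel_iff order.strict_trans)
    then have "C / ln (exp 1 + 1 / u) < \<epsilon>"
      using \<epsilon> C by (smt (verit) divide_pos_pos mult.commute pos_divide_less_eq)
    then have "\<bar>p x - p y\<bar> < \<epsilon>"
      using log[of x y] by (simp add: u_def)
    then show ?thesis
      by (simp add: \<epsilon>_def)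
  qed
  moreover obtain N where "{x. \<not> r \<le> p x} \<subseteq> N" "N \<in> null_sets lebesgue"
    using ae by (auto simp: eventually_ae_filter)
  ultimately have "ball x h \<subseteq> N"
    by (auto simp: subset_iff not_le)
  then have "negligible (ball x h)"
    using \<open>N \<in> null_sets lebesgue\<close> negligible_subset
    by (auto simp: negligible_iff_null_sets[symmetric])
  then show False
    using h open_not_negligible[of "ball x h"] by simp
qed

lemma limit_at_infinity_ge:
  fixes p :: "real ^ 'n \<Rightarrow> real"
  assumes C: "0 < C" and log: "\<And>x. \<bar>p x - p_inf\<bar> \<le> C / ln (exp 1 + norm x)"
    and ge: "\<And>x. r \<le> p x"
  shows "r \<le> p_inf"
proof (rule field_le_epsilon)
  fix \<epsilon> :: real assume \<epsilon>: "0 < \<epsilon>"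
  \<comment> \<open>At this norm the logarithm is at least \<open>C / \<epsilon>\<close>, so
    \<open>p x\<close> is within \<epsilon> of \<open>p_inf\<close>.\<close>
  obtain x :: "real ^ 'n" where x: "norm x = exp (C / \<epsilon>)"
    using vector_choose_size[of "exp (C / \<epsilon>)"] by auto
  have "ln (exp (C / \<epsilon>)) \<le> ln (exp 1 + norm x)"
    unfolding x by (subst ln_le_cancel_iff) (auto intro: add_pos_pos)
  then have "C / \<epsilon> \<le> ln (exp 1 + norm x)"
    by simp
  moreover have "0 < C / \<epsilon>"
    using C \<epsilon> by simp
  ultimately have "C / ln (exp 1 + norm x) \<le> C / (C / \<epsilon>)"
    using C by (intro divide_left_mono mult_pos_pos) linarith+
  also have "\<dots> = \<epsilon>"
    using C by simp
  finally show "r \<le> p_inf + \<epsilon>"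
    using log[of x] ge[of x] by linarith
qed

theorem mainTheorem4:
  fixes p \<delta> :: "real ^ 'n \<Rightarrow> real" and p_inf \<beta> :: real
  assumes "p \<in> log_exponents"
    and "log_holder_at_infinity p p_inf"
    and "\<And>x. 0 \<le> \<delta> x \<and> \<delta> x < real CARD('n)"
    and "1 < \<beta>" and "ereal \<beta> < p_minus p"
    and "AE x in lebesgue. p_inf \<le> p x"
    and "\<And>x. \<delta> x / real CARD('n) = 1 / \<beta> - 1 / p x"
  shows "ae_class (pointwise_Lip \<delta>) =
           (integral_Lip \<beta> p :: (real ^ 'n \<Rightarrow> 'a::{real_normed_field, euclidean_space}) set) \<and>
         (\<exists>C>0. \<forall>(b :: real ^ 'n \<Rightarrow> 'a) b'.
            b \<in> integral_Lip \<beta> p \<longrightarrow> b' \<in> pointwise_Lip \<delta> \<longrightarrow> (AE x in lebesgue. b x = b' x) \<longrightarrow>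
              ennreal (1 / C) * integral_Lip_norm \<beta> p b \<le> pointwise_Lip_norm \<delta> b' \<and>
              pointwise_Lip_norm \<delta> b' \<le> ennreal C * integral_Lip_norm \<beta> p b)"
proof -
  obtain C where C: "0 < C" "\<And>x y. \<bar>p x - p y\<bar> \<le> C / ln (exp 1 + 1 / norm (x - y))"
    using assms(1) by (auto simp: log_exponents_def log_holder_def)
  obtain C_inf where C_inf: "0 < C_inf" "\<And>x. \<bar>p x - p_inf\<bar> \<le> C_inf / ln (exp 1 + norm x)"
    using assms(2) by (auto simp: log_holder_at_infinity_def)
  obtain m where m: "\<beta> < m" "ereal m < p_minus p"
    using ereal_dense2[OF assms(5)] by auto
  have p_ge: "m \<le> p x" for x
  proof -
    have "p_minus p \<le> ereal (p x)"
      unfolding p_minus_def by (rule INF_lower) simp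
    then have "ereal m \<le> ereal (p x)"
      using m(2) by (meson less_imp_le order_trans)
    then show ?thesis
      by simp
  qed
  interpret log_holder_exponent p p_inf \<beta> C C_inf m
  proof
    show "1 < \<beta>" "\<beta> < m" "0 < C" "0 < C_inf"
      by (fact assms(4) m(1) C(1) C_inf(1))+
    fix x y
    show "m \<le> p x"
      by (rule p_ge)
    show "m \<le> p_inf"
      by (rule limit_at_infinity_ge[OF C_inf p_ge])
    show "p_inf \<le> p x"
      by (rule log_holder_ge_of_AE_ge[OF C assms(6)])
    show "\<bar>p x - p y\<bar> \<le> C / ln (exp 1 + 1 / norm (x - y))"
      by (rule C(2))
    show "\<bar>p x - p_inf\<bar> \<le> C_inf / ln (exp 1 + norm x)"
      by (rule C_inf(2))
  qed
  have \<delta>_eq: "\<delta> = order"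
  proof
    fix x
    show "\<delta> x = order x"
      using assms(7)[of x] by (simp add: order_def field_simps)
  qed
  obtain c where c: "0 \<le> c" and lip: "\<And>(b :: real ^ 'n \<Rightarrow> 'a) N. 0 \<le> N \<Longrightarrow> locally_integrable b \<Longrightarrow>
      integral_Lip_norm \<beta> p b \<le> ennreal N \<Longrightarrow>
      \<exists>b'. (AE x in lebesgue. b x = b' x) \<and> lip_bound \<delta> b' (c * N)"
    using lip_bound_of_integral_Lip_norm[where 'a = 'a] unfolding \<delta>_eq by blast
  have continuous: "continuous_on UNIV b" if "lip_bound \<delta> b B" for b :: "real ^ 'n \<Rightarrow> 'a" and B
    using that order_pos unfolding \<delta>_eq by (rule continuous_on_of_lip_bound)
  have norm_le: "integral_Lip_norm \<beta> p b \<le> ennreal (K_osc * B)"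
    if "AE x in lebesgue. b x = b' x" "lip_bound \<delta> b' B" for b b' :: "real ^ 'n \<Rightarrow> 'a" and B
    using integral_Lip_norm_cong_AE[OF that(1)] integral_Lip_norm_le[of b' B] that(2)
      locally_integrable_continuous[OF continuous[OF that(2)]] by (simp add: \<delta>_eq)
  have integral_norm: "\<exists>N\<ge>0. integral_Lip_norm \<beta> p b = ennreal N"
    if "b \<in> integral_Lip \<beta> p" for b :: "real ^ 'n \<Rightarrow> 'a"
    using that by (cases "integral_Lip_norm \<beta> p b") (auto simp: integral_Lip_def)
  show ?thesis
  proof (rule conjI)
    show "ae_class (pointwise_Lip \<delta>) = (integral_Lip \<beta> p :: (real ^ 'n \<Rightarrow> 'a) set)"
    proof (intro equalityI subsetI)
      fix b :: "real ^ 'n \<Rightarrow> 'a"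
      assume "b \<in> ae_class (pointwise_Lip \<delta>)"
      then obtain b' B where ae: "AE x in lebesgue. b x = b' x" and b': "lip_bound \<delta> b' B"
        by (auto simp: ae_class_def pointwise_Lip_def)
      have "locally_integrable b"
        by (rule locally_integrable_cong_AE[OF ae locally_integrable_continuous[OF continuous[OF b']]])
      moreover have "integral_Lip_norm \<beta> p b < \<infinity>"
        using norm_le[OF ae b'] by (auto simp: less_top[symmetric] top_unique)
      ultimately show "b \<in> integral_Lip \<beta> p"
        by (simp add: integral_Lip_def)
    next
      fix b :: "real ^ 'n \<Rightarrow> 'a"
      assume b: "b \<in> integral_Lip \<beta> p"
      obtain N where "0 \<le> N" "integral_Lip_norm \<beta> p b = ennreal N"
        using integral_norm[OF b] by blast
      then show "b \<in> ae_class (pointwise_Lip \<delta>)"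
        using lip[of N b] b by (auto simp: integral_Lip_def ae_class_def pointwise_Lip_def)
    qed
    show "\<exists>C>0. \<forall>(b :: real ^ 'n \<Rightarrow> 'a) b'.
      b \<in> integral_Lip \<beta> p \<longrightarrow> b' \<in> pointwise_Lip \<delta> \<longrightarrow> (AE x in lebesgue. b x = b' x) \<longrightarrow>
        ennreal (1 / C) * integral_Lip_norm \<beta> p b \<le> pointwise_Lip_norm \<delta> b' \<and>
        pointwise_Lip_norm \<delta> b' \<le> ennreal C * integral_Lip_norm \<beta> p b"
    \<comment> \<open>The sum serves both inequalities at once; adding 1 makes it positive even if
      the other terms vanish.\<close>
    proof (intro exI[of _ "K_osc + c + 1"] conjI allI impI)
      show "0 < K_osc + c + 1"
        using K_osc_nonneg c by simp
      fix b b' :: "real ^ 'n \<Rightarrow> 'a"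
      assume b: "b \<in> integral_Lip \<beta> p" and b': "b' \<in> pointwise_Lip \<delta>"
        and ae: "AE x in lebesgue. b x = b' x"
      show "ennreal (1 / (K_osc + c + 1)) * integral_Lip_norm \<beta> p b \<le> pointwise_Lip_norm \<delta> b'"
        unfolding pointwise_Lip_norm_def
      proof (rule INF_greatest)
        fix B assume "B \<in> {B. lip_bound \<delta> b' B}"
        then have B: "lip_bound \<delta> b' B" "0 \<le> B"
          by (auto simp: lip_bound_def)
        have "ennreal (1 / (K_osc + c + 1)) * integral_Lip_norm \<beta> p b
            \<le> ennreal (1 / (K_osc + c + 1)) * ennreal (K_osc * B)"
          by (intro mult_left_mono norm_le[OF ae B(1)]) simp
        also have "\<dots> = ennreal (1 / (K_osc + c + 1) * (K_osc * B))"
          using K_osc_nonneg c by (intro ennreal_mult'[symmetric]) simp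
        also have "\<dots> \<le> ennreal B"
        proof (rule ennreal_leI)
          have "K_osc * B \<le> (K_osc + c + 1) * B"
            using B(2) c by (intro mult_right_mono) auto
          then show "1 / (K_osc + c + 1) * (K_osc * B) \<le> B"
            using K_osc_nonneg c by (simp add: divide_le_eq mult.commute)
        qed
        finally show "ennreal (1 / (K_osc + c + 1)) * integral_Lip_norm \<beta> p b \<le> ennreal B" .
      qed
      obtain N where N: "0 \<le> N" "integral_Lip_norm \<beta> p b = ennreal N"
        using integral_norm[OF b] by blast
      obtain b'' where b'': "AE x in lebesgue. b x = b'' x" "lip_bound \<delta> b'' (c * N)"
        using lip[OF N(1), of b] N(2) b unfolding integral_Lip_def by auto
      have "AE x in lebesgue. b' x = b'' x"
        using ae b''(1) by eventually_elim simp
      moreover obtain B where "lip_bound \<delta> b' B"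
        using b' by (auto simp: pointwise_Lip_def)
      \<comment> \<open>The bound is known for the function \<open>b''\<close> built from averages;
        continuity identifies it with the given \<open>b'\<close> at every point.\<close>
      ultimately have "b' = b''"
        using continuous_eq_if_AE_eq[OF continuous continuous[OF b''(2)]] by (intro ext) blast
      then have "pointwise_Lip_norm \<delta> b' \<le> ennreal (c * N)"
        unfolding pointwise_Lip_norm_def using b''(2) by (intro INF_lower) simp
      also have "\<dots> \<le> ennreal ((K_osc + c + 1) * N)"
        using K_osc_nonneg N(1) by (intro ennreal_leI mult_right_mono) auto
      also have "\<dots> = ennreal (K_osc + c + 1) * integral_Lip_norm \<beta> p b"
        using K_osc_nonneg c by (simp add: N(2) ennreal_mult')
      finally show "pointwise_Lip_norm \<delta> b' \<le> ennreal (K_osc + c + 1) * integral_Lip_norm \<beta> p b" .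
    qed
  qed
qed

end
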